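(* For every $i\in I$, the automorphisms $T_i$ and $T_i^{-1}$ of $\mathbf U$ restrict to automorphisms of the integral form ${}_{\mathcal A}\mathbf U$.
   Context: Data. $I=I_{\bar 0}\sqcup I_{\bar 1}$ is a finite set with $|I|=\ell$ and $I_{\bar 1}\ne\emptyset$; $p(i)=0$ for $i\in I_{\bar 0}$, $p(i)=1$ for $i\in I_{\bar 1}$. $A=(a_{ij})_{i,j\in I}$ is an integer matrix with $a_{ii}=2$, $a_{ij}\le 0$ for $i\ne j$, $a_{ij}=0\iff a_{ji}=0$; $d_i$ ($i\in I$) are positive integers with gcd $1$ and $d_ia_{ij}=d_ja_{ji}$. Standing assumptions: $a_{ij}$ is even for all $i\in I_{\bar 1}$, $j\in I$; and $d_i\equiv p(i)\pmod 2$. $P,P^\vee$ are free $\mathbb Z$-modules of rank $\ell$ with a perfect pairing $\langle\cdot,\cdot\rangle:P^\vee\times P\to\mathbb Z$, linearly independent simple roots $\alpha_i\in P$ and linearly independent simple coroots $\alpha_i^\vee\in P^\vee$ ($i\in I$), with $\langle\alpha_i^\vee,\alpha_j\rangle=a_{ij}$. $s_i(\mu)=\mu-\langle\mu,\alpha_i\rangle\alpha_i^\vee$ on $P^\vee$. Parameters. $\mathbb Q(q)^\pi=\mathbb Q(q)[\pi]/(\pi^2-1)$, $\mathcal A=\mathbb Z[\pi]/(\pi^2-1)[q,q^{-1}]$, $q_i=q^{d_i}$, $\pi_i=\pi^{d_i}$, $[n]_i=\frac{(\pi_iq_i)^n-q_i^{-n}}{\pi_iq_i-q_i^{-1}}$,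 $[n]_i^!=\prod_{l=1}^n[l]_i$, $\binom{n}{k}_i=\frac{[n]_i^!}{[k]_i^![n-k]_i^!}$ for $0\le k\le n$. Ordinary $\binom{a}{2}=a(a-1)/2$ for $a\in\mathbb Z$. Algebra. $\mathbf U$ is the $\mathbb Q(q)^\pi$-algebra generated by $E_i,F_i$ ($i\in I$), $K_\mu,J_\mu$ ($\mu\in P^\vee$) with relations: $J_\mu J_\nu=J_{\mu+\nu}$, $K_\mu K_\nu=K_{\mu+\nu}$, $K_0=J_0=J_\nu^2=1$, $J_\mu K_\nu=K_\nu J_\mu$; $J_\mu E_i=\pi^{\langle\mu,\alpha_i\rangle}E_iJ_\mu$, $J_\mu F_i=\pi^{-\langle\mu,\alpha_i\rangle}F_iJ_\mu$; $K_\mu E_i=q^{\langle\mu,\alpha_i\rangle}E_iK_\mu$, $K_\mu F_i=q^{-\langle\mu,\alpha_i\rangle}F_iK_\mu$; $E_iF_j-\pi^{p(i)p(j)}F_jE_i=\delta_{ij}\frac{\tilde J_i\tilde K_i-\tilde K_i^{-1}}{\pi_iq_i-q_i^{-1}}$ where $\tilde J_i=J_{d_i\alpha_i^\vee}$, $\tilde K_i=K_{d_i\alpha_i^\vee}$; and for $i\ne j$, with $b_{ij}=1-a_{ij}$, $\sum_{k=0}^{b_{ij}}(-1)^k\pi^{\binom k2p(i)+kp(i)p(j)}\binom{b_{ij}}{k}_iX_i^{b_{ij}-k}X_jX_i^k=0$ for $X=E$ and $X=F$. Divided powers: $E_i^{(n)}=E_i^n/[n]_i^!$, $F_i^{(n)}=F_i^n/[n]_i^!$.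 Integral form. ${}_{\mathcal A}\mathbf U$ is the $\mathcal A$-subalgebra of $\mathbf U$ generated by all $E_i^{(n)},F_i^{(n)}$ ($i\in I$, $n\ge0$) and all $J_\nu,K_\nu$ ($\nu\in P^\vee$). Braid automorphisms. $T_i$ is the $\mathbb Q(q)^\pi$-algebra automorphism of $\mathbf U$ determined by $T_i(E_i)=-\pi_i\tilde J_i\tilde K_iF_i$, $T_i(F_i)=-E_i\tilde K_i^{-1}$, $T_i(K_\mu)=K_{s_i(\mu)}$, $T_i(J_\mu)=J_{s_i(\mu)}$, and for $j\ne i$, with sums over $r,s\ge 0$, $r+s=-a_{ij}$, $T_i(E_j)=\pi_i^{\binom{a_{ij}}2}\tilde J_i^{p(j)}\sum(-1)^r\pi_i^{rp(i)p(j)+\binom r2p(i)}(\pi_iq_i)^rE_i^{(r)}E_jE_i^{(s)}$ and $T_i(F_j)=\tilde J_i^{p(j)}\sum(-1)^r\pi_i^{rp(i)p(j)+\binom r2p(i)}q_i^{-r}F_i^{(s)}F_jF_i^{(r)}$. $T_i^{-1}$ is its inverse. *)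

theory Defs
  imports
    "HOL-Library.Poly_Mapping"
    "HOL-Computational_Algebra.Polynomial"
    "HOL-Computational_Algebra.Fraction_Field"
    "HOL-Algebra.QuotRing"
    "HOL-Algebra.Subrings"
begin

section \<open>Free \<open>\<int>\<close>-modules\<close>

definition zmul :: "int \<Rightarrow> 'a::ab_group_add \<Rightarrow> 'a" where
  "zmul n x = (if 0 \<le> n then ((+) x ^^ nat n) 0 else - ((+) x ^^ nat (- n)) 0)"

lemma zmul_0 [simp]: "zmul 0 x = 0"
  by (simp add: zmul_def)

lemma zmul_add1: "zmul (n + 1) x = x + zmul n x"
proof (cases "0 \<le> n")
  case True
  then have "nat (n + 1) = Suc (nat n)" by simp
  with True show ?thesis by (simp add: zmul_def)
next
  case False
  then have "nat (- n) = Suc (nat (- (n + 1)))" by simp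
  then have "((+) x ^^ nat (- n)) 0 = x + ((+) x ^^ nat (- (n + 1))) 0" by simp
  with False show ?thesis
    by (cases "n = - 1") (auto simp: zmul_def)
qed

lemma zmul_minus1: "zmul (n - 1) x = zmul n x - x"
  using zmul_add1[of "n - 1" x] by simp

lemma zmul_add_left: "zmul (m + n) x = zmul m x + zmul n x"
proof (induction m rule: int_induct[where k = 0])
  case (step1 m)
  then show ?case using zmul_add1[of "m + n" x] zmul_add1[of m x] by (simp add: algebra_simps)
next
  case (step2 m)
  have "m - 1 + n = (m + n) - 1" by simp
  then show ?case using step2 by (simp only: zmul_minus1) simp
qed simp

lemma zmul_add_right: "zmul n (x + y) = zmul n x + zmul n y"
  by (induction n rule: int_induct[where k = 0])
     (simp_all add: zmul_add1 zmul_minus1 algebra_simps)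

lemma zmul_1: "zmul 1 x = x"
  using zmul_add1[of 0 x] by simp

lemma zmul_mult: "zmul m (zmul n x) = zmul (m * n) x"
proof (induction m rule: int_induct[where k = 0])
  case (step1 m)
  have "(m + 1) * n = n + m * n" by (simp add: algebra_simps)
  then have "zmul ((m + 1) * n) x = zmul n x + zmul (m * n) x" by (simp only: zmul_add_left)
  then show ?case using step1 zmul_add1[of m "zmul n x"] by simp
next
  case (step2 m)
  have "m * n = n + (m - 1) * n" by (simp add: algebra_simps)
  then have "zmul (m * n) x = zmul n x + zmul ((m - 1) * n) x" by (simp only: zmul_add_left)
  then show ?case using step2 by (simp add: zmul_minus1)
qed simp

interpretation zmod: Modules.module zmul
  by unfold_locales (simp_all add: zmul_add_left zmul_add_right zmul_mult zmul_1)

definition free_of_rank :: "'a::ab_group_add itself \<Rightarrow> nat \<Rightarrow> bool" where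
  "free_of_rank _ n \<longleftrightarrow>
     (\<exists>B :: 'a set. finite B \<and> card B = n \<and> zmod.independent B \<and> zmod.span B = UNIV)"

text \<open>A bilinear pairing is perfect if both induced maps to the dual modules are bijective.\<close>

definition perfect_pairing ::
    "('y::ab_group_add \<Rightarrow> 'x::ab_group_add \<Rightarrow> int) \<Rightarrow> bool" where
  "perfect_pairing B \<longleftrightarrow>
     (\<forall>\<mu>. Modules.additive (B \<mu>)) \<and> (\<forall>x. Modules.additive (\<lambda>\<mu>. B \<mu> x)) \<and>
     (\<forall>f. Modules.additive f \<longrightarrow> (\<exists>!\<mu>. B \<mu> = f)) \<and>
     (\<forall>g. Modules.additive g \<longrightarrow> (\<exists>!x. (\<lambda>\<mu>. B \<mu> x) = g))"

section \<open>The Cartan data\<close>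

text \<open>The index set \<open>I\<close> is the finite type \<open>'i\<close>, the weight lattice \<open>P\<close> is the type \<open>'x\<close>
  and the coweight lattice \<open>P\<^sup>\<or>\<close> is the type \<open>'y\<close>.\<close>

record ('i, 'x, 'y) super_datum =
  odd_part :: "'i set"
  cartan :: "'i \<Rightarrow> 'i \<Rightarrow> int"
  symm :: "'i \<Rightarrow> nat"
  pairing :: "'y \<Rightarrow> 'x \<Rightarrow> int"
  root :: "'i \<Rightarrow> 'x"
  coroot :: "'i \<Rightarrow> 'y"

definition par :: "('i, 'x, 'y) super_datum \<Rightarrow> 'i \<Rightarrow> nat" where
  "par D i = (if i \<in> odd_part D then 1 else 0)"

locale covering_datum =
  fixes D :: "('i::finite, 'x::ab_group_add, 'y::ab_group_add) super_datum"
  assumes odd_nonempty: "odd_part D \<noteq> {}"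
    and cartan_diag: "\<And>i. cartan D i i = 2"
    and cartan_offdiag: "\<And>i j. i \<noteq> j \<Longrightarrow> cartan D i j \<le> 0"
    and cartan_zero: "\<And>i j. cartan D i j = 0 \<longleftrightarrow> cartan D j i = 0"
    and symm_pos: "\<And>i. symm D i > 0"
    and symm_gcd: "Gcd (range (symm D)) = 1"
    and symmetrizable: "\<And>i j. int (symm D i) * cartan D i j = int (symm D j) * cartan D j i"
    and cartan_odd: "\<And>i j. i \<in> odd_part D \<Longrightarrow> even (cartan D i j)"
    and symm_par: "\<And>i. symm D i mod 2 = par D i mod 2"
    and weights_free: "free_of_rank TYPE('x) (card (UNIV :: 'i set))"
    and coweights_free: "free_of_rank TYPE('y) (card (UNIV :: 'i set))"
    and pairing_perfect: "perfect_pairing (pairing D)"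
    and roots_independent: "inj (root D)" "zmod.independent (range (root D))"
    and coroots_independent: "inj (coroot D)" "zmod.independent (range (coroot D))"
    and pairing_cartan: "\<And>i j. pairing D (coroot D i) (root D j) = cartan D i j"

definition reflect :: "('i, 'x, 'y::ab_group_add) super_datum \<Rightarrow> 'i \<Rightarrow> 'y \<Rightarrow> 'y" where
  "reflect D i \<mu> = \<mu> - zmul (pairing D \<mu> (root D i)) (coroot D i)"

section \<open>The ring \<open>\<rat>(q)[\<pi>]/(\<pi>\<^sup>2 - 1)\<close>\<close>

text \<open>\<open>QPi a b\<close> represents the class of \<open>a + b \<pi>\<close>.\<close>

datatype qpi = QPi (coeff1: "rat poly fract") (coeffpi: "rat poly fract")

instantiation qpi :: comm_ring_1
begin
definition "0 = QPi 0 0"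
definition "1 = QPi 1 0"
definition "x + y = QPi (coeff1 x + coeff1 y) (coeffpi x + coeffpi y)"
definition "x - y = QPi (coeff1 x - coeff1 y) (coeffpi x - coeffpi y)"
definition "- x = QPi (- coeff1 x) (- coeffpi x)"
definition "x * y = QPi (coeff1 x * coeff1 y + coeffpi x * coeffpi y)
                        (coeff1 x * coeffpi y + coeffpi x * coeff1 y)"
instance
  by standard
     (simp_all add: zero_qpi_def one_qpi_def plus_qpi_def minus_qpi_def uminus_qpi_def
        times_qpi_def algebra_simps)
end

text \<open>Division multiplies by the inverse of a unit; every denominator used below is a unit.
  The inverse of \<open>a + b \<pi>\<close> is \<open>(a - b \<pi>) / (a\<^sup>2 - b\<^sup>2)\<close>; a non-unit gets the junk value \<open>0\<close>.\<close>

instantiation qpi :: inverse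
begin
definition "inverse x =
  QPi (coeff1 x / (coeff1 x ^ 2 - coeffpi x ^ 2)) (- coeffpi x / (coeff1 x ^ 2 - coeffpi x ^ 2))"
definition "x div y = x * inverse (y :: qpi)"
instance ..
end

lemma qpi_mult_inverse:
  assumes "a ^ 2 - b ^ 2 \<noteq> 0"
  shows "QPi a b * inverse (QPi a b) = 1"
proof -
  define N where "N = a ^ 2 - b ^ 2"
  have "N \<noteq> 0" using assms unfolding N_def .
  have "a * (a / N) + b * (- b / N) = (a ^ 2 - b ^ 2) / N"
    by (simp add: power2_eq_square diff_divide_distrib)
  also have "\<dots> = 1" using \<open>N \<noteq> 0\<close> by (simp flip: N_def)
  finally have "a * (a / N) + b * (- b / N) = 1" .
  moreover have "a * (- b / N) + b * (a / N) = 0" by simp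
  ultimately show ?thesis
    by (simp only: inverse_qpi_def times_qpi_def one_qpi_def qpi.sel flip: N_def)
qed

lemma qpi_inverse:
  assumes "x dvd (1 :: qpi)"
  shows "x * inverse x = 1"
proof -
  obtain y where y: "x * y = 1" using assms by (auto elim!: dvdE)
  obtain a b where x: "x = QPi a b" by (cases x)
  obtain c d where y': "y = QPi c d" by (cases y)
  have e: "a * c + b * d = 1" "a * d + b * c = 0"
    using y by (simp_all add: x y' times_qpi_def one_qpi_def)
  have "(a ^ 2 - b ^ 2) * (c ^ 2 - d ^ 2) = (a * c + b * d) ^ 2 - (a * d + b * c) ^ 2"
    by (simp add: power2_eq_square algebra_simps)
  then have "a ^ 2 - b ^ 2 \<noteq> 0" by (auto simp: e)
  then show ?thesis unfolding x by (rule qpi_mult_inverse)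
qed

definition qvar :: qpi where "qvar = QPi (Fract [:0, 1:] 1) 0"
definition pivar :: qpi where "pivar = QPi 0 1"

lemma pivar_square: "pivar ^ 2 = 1"
  by (simp add: pivar_def power2_eq_square times_qpi_def one_qpi_def)

definition laurent_int :: "rat poly fract set" where
  "laurent_int = {Fract (map_poly of_int f) ([:0, 1:] ^ n) | (f :: int poly) n. True}"

text \<open>The subring \<open>\<A> = \<int>[\<pi>]/(\<pi>\<^sup>2 - 1)[q, q\<^sup>-\<^sup>1]\<close>.\<close>

definition scalarsA :: "qpi set" where
  "scalarsA = {QPi a b | a b. a \<in> laurent_int \<and> b \<in> laurent_int}"

section \<open>Quantum integers\<close>

definition q_at :: "('i, 'x, 'y) super_datum \<Rightarrow> 'i \<Rightarrow> qpi" where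
  "q_at D i = qvar ^ symm D i"

definition pi_at :: "('i, 'x, 'y) super_datum \<Rightarrow> 'i \<Rightarrow> qpi" where
  "pi_at D i = pivar ^ symm D i"

definition q_den :: "('i, 'x, 'y) super_datum \<Rightarrow> 'i \<Rightarrow> qpi" where
  "q_den D i = pi_at D i * q_at D i - inverse (q_at D i)"

definition q_int :: "('i, 'x, 'y) super_datum \<Rightarrow> 'i \<Rightarrow> nat \<Rightarrow> qpi" where
  "q_int D i n = ((pi_at D i * q_at D i) ^ n - inverse (q_at D i) ^ n) / q_den D i"

definition q_fact :: "('i, 'x, 'y) super_datum \<Rightarrow> 'i \<Rightarrow> nat \<Rightarrow> qpi" where
  "q_fact D i n = (\<Prod>l = 1..n. q_int D i l)"

definition q_binom :: "('i, 'x, 'y) super_datum \<Rightarrow> 'i \<Rightarrow> nat \<Rightarrow> nat \<Rightarrow> qpi" where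
  "q_binom D i n k = q_fact D i n / (q_fact D i k * q_fact D i (n - k))"

text \<open>The denominators are units, as both specializations \<open>\<pi> = \<plusminus> 1\<close> are nonzero.\<close>

definition specialize :: "rat poly fract \<Rightarrow> qpi \<Rightarrow> rat poly fract" where
  "specialize e x = coeff1 x + e * coeffpi x"

lemma specialize_simps:
  assumes "e ^ 2 = 1"
  shows "specialize e (x * y) = specialize e x * specialize e y"
    and "specialize e (x - y) = specialize e x - specialize e y"
    and "specialize e (x ^ n) = specialize e x ^ n"
    and "specialize e 1 = 1"
    and "specialize e pivar = e"
proof -
  have e: "e * (e * z) = z" for z
    using assms by (simp add: power2_eq_square flip: mult.assoc)
  show mult: "specialize e (x * y) = specialize e x * specialize e y" for x y
    by (simp add: specialize_def times_qpi_def algebra_simps e)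
  show "specialize e (x - y) = specialize e x - specialize e y"
    by (simp add: specialize_def minus_qpi_def algebra_simps)
  show one: "specialize e 1 = 1"
    by (simp add: specialize_def one_qpi_def)
  show "specialize e (x ^ n) = specialize e x ^ n"
    by (induction n) (simp_all add: mult one)
  show "specialize e pivar = e"
    by (simp add: specialize_def pivar_def)
qed

lemma qpi_unitI:
  assumes "\<And>e. e ^ 2 = 1 \<Longrightarrow> specialize e x \<noteq> 0"
  shows "x dvd (1 :: qpi)"
proof -
  obtain a b where x: "x = QPi a b" by (cases x)
  have "a + b \<noteq> 0" "a - b \<noteq> 0"
    using assms[of 1] assms[of "- 1"] by (simp_all add: x specialize_def)
  then have "a ^ 2 - b ^ 2 \<noteq> 0"
    by (simp add: power2_eq_square square_diff_square_factored)
  then have "x * inverse x = 1" unfolding x by (rule qpi_mult_inverse)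
  then show ?thesis by (metis dvd_triv_left)
qed

lemma qvar_power_neq:
  fixes e :: "rat poly fract"
  assumes e: "e ^ 2 = 1" and m: "m > 0"
  shows "e * Fract [:0, 1:] 1 ^ m \<noteq> 1"
proof
  assume eq: "e * Fract [:0, 1:] 1 ^ m = 1"
  have p: "(Fract [:0, 1:] 1 :: rat poly fract) ^ n = Fract ([:0, 1:] ^ n) 1" for n
    by (induction n) (simp_all add: One_fract_def)
  have "(e * Fract [:0, 1:] 1 ^ m) ^ 2 = 1" using eq by simp
  then have "(Fract [:0, 1:] 1 :: rat poly fract) ^ (m * 2) = 1"
    by (simp add: power_mult_distrib e power_mult)
  then have "[:0, 1:] ^ (m * 2) = (1 :: rat poly)"
    by (simp only: p One_fract_def) (simp add: eq_fract)
  then have "poly ([:0, 1:] ^ (m * 2)) 0 = (1 :: rat)" by simp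
  with m show False by (simp add: poly_power zero_power)
qed

lemma q_at_unit: "q_at D i dvd 1"
proof (rule qpi_unitI)
  fix e :: "rat poly fract" assume e: "e ^ 2 = 1"
  show "specialize e (q_at D i) \<noteq> 0"
    unfolding q_at_def specialize_simps(3)[OF e]
    by (simp add: specialize_def qvar_def) (simp add: Zero_fract_def eq_fract)
qed

lemma q_numerator_unit:
  assumes "symm D i > 0" "n > 0"
  shows "((pi_at D i * q_at D i) ^ n - inverse (q_at D i) ^ n) dvd 1"
proof (rule qpi_unitI)
  fix e :: "rat poly fract" assume e: "e ^ 2 = 1"
  note [simp] = specialize_simps[OF e]
  let ?Q = "specialize e (q_at D i)" and ?R = "specialize e (inverse (q_at D i))"
  have Q: "?Q = Fract [:0, 1:] 1 ^ symm D i"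
    by (simp add: q_at_def) (simp add: specialize_def qvar_def)
  have "?Q * ?R = 1"
    using arg_cong[OF qpi_inverse[OF q_at_unit], of "specialize e" D i] by simp
  then have R: "?Q ^ n * ?R ^ n = 1"
    by (simp flip: power_mult_distrib)
  show "specialize e ((pi_at D i * q_at D i) ^ n - inverse (q_at D i) ^ n) \<noteq> 0"
  proof
    assume "specialize e ((pi_at D i * q_at D i) ^ n - inverse (q_at D i) ^ n) = 0"
    then have "(e ^ symm D i * ?Q) ^ n = ?R ^ n" by (simp add: pi_at_def)
    then have "?Q ^ n * (e ^ symm D i * ?Q) ^ n = 1" using R by simp
    then have "e ^ (symm D i * n) * Fract [:0, 1:] 1 ^ (2 * symm D i * n) = 1"
      by (simp add: Q power_mult_distrib algebra_simps power2_eq_square flip: power_mult)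
         (simp add: mult_2_right power_add algebra_simps)
    moreover have "(e ^ (symm D i * n)) ^ 2 = 1"
      by (metis e mult.commute power_mult power_one)
    ultimately show False
      using qvar_power_neq[of "e ^ (symm D i * n)" "2 * symm D i * n"] assms by simp
  qed
qed

lemma q_den_unit: "symm D i > 0 \<Longrightarrow> q_den D i dvd 1"
  using q_numerator_unit[of D i 1] by (simp add: q_den_def)

lemma q_int_unit:
  assumes "symm D i > 0" "n > 0" shows "q_int D i n dvd 1"
proof -
  have "inverse (q_den D i) dvd 1"
    using qpi_inverse[OF q_den_unit[OF assms(1)]] by (metis dvd_triv_right)
  then show ?thesis
    using mult_dvd_mono[OF q_numerator_unit[OF assms]]
    by (fastforce simp: q_int_def divide_qpi_def)
qed

lemma q_fact_unit: "symm D i > 0 \<Longrightarrow> q_fact D i n dvd 1"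
proof -
  assume d: "symm D i > 0"
  have "(\<Prod>l = 1..n. q_int D i l) dvd (\<Prod>l = 1..n. 1)"
    by (rule prod_dvd_prod) (auto intro: q_int_unit d)
  then show ?thesis by (simp add: q_fact_def)
qed

section \<open>Free associative algebras\<close>

datatype 'g free_monoid = Letters "'g list"

instantiation free_monoid :: (type) monoid_add
begin
definition "0 = Letters []"
fun plus_free_monoid :: "'a free_monoid \<Rightarrow> 'a free_monoid \<Rightarrow> 'a free_monoid" where
  "Letters u + Letters v = Letters (u @ v)"
instance
proof
  fix u v w :: "'a free_monoid"
  show "u + v + w = u + (v + w)" by (cases u; cases v; cases w) simp
  show "0 + u = u" "u + 0 = u" by (cases u; simp add: zero_free_monoid_def)+
qed
end

text \<open>The monoid algebra of the free monoid on \<open>'g\<close>: multiplication in \<open>poly_mapping\<close> is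
  convolution, and the monoid is written additively.\<close>

type_synonym 'g free_alg = "'g free_monoid \<Rightarrow>\<^sub>0 qpi"

definition gen :: "'g \<Rightarrow> 'g free_alg" where
  "gen g = Poly_Mapping.single (Letters [g]) 1"

definition scal :: "qpi \<Rightarrow> 'g free_alg" where
  "scal c = Poly_Mapping.single 0 c"

definition free_alg_ring :: "'g free_alg ring" where
  "free_alg_ring = \<lparr>carrier = UNIV, mult = (*), one = 1, zero = 0, add = (+)\<rparr>"

lemma ring_free_alg: "ring (free_alg_ring :: 'g free_alg ring)"
proof (rule ringI)
  show "abelian_group (free_alg_ring :: 'g free_alg ring)"
  proof (rule abelian_groupI)
    fix x :: "'g free_alg"
    show "\<exists>y\<in>carrier free_alg_ring. y \<oplus>\<^bsub>free_alg_ring\<^esub> x = \<zero>\<^bsub>free_alg_ring\<^esub>"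
      by (rule bexI[of _ "- x"]) (simp_all add: free_alg_ring_def)
  qed (simp_all add: free_alg_ring_def algebra_simps)
  show "monoid (free_alg_ring :: 'g free_alg ring)"
    by (rule monoidI) (simp_all add: free_alg_ring_def algebra_simps)
qed (simp_all add: free_alg_ring_def algebra_simps)

section \<open>The quantum covering group\<close>

datatype ('i, 'y) generator = GE 'i | GF 'i | GK 'y | GJ 'y

type_synonym ('i, 'y) falg = "('i, 'y) generator free_alg"

abbreviation fE :: "'i \<Rightarrow> ('i, 'y) falg" where "fE i \<equiv> gen (GE i)"
abbreviation fF :: "'i \<Rightarrow> ('i, 'y) falg" where "fF i \<equiv> gen (GF i)"
abbreviation fK :: "'y \<Rightarrow> ('i, 'y) falg" where "fK \<mu> \<equiv> gen (GK \<mu>)"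
abbreviation fJ :: "'y \<Rightarrow> ('i, 'y) falg" where "fJ \<mu> \<equiv> gen (GJ \<mu>)"

text \<open>\<open>fKt'\<close> represents the inverse of \<open>fKt\<close>, by \<open>K\<^sub>\<mu> K\<^sub>\<nu> = K\<^sub>\<mu>\<^sub>+\<^sub>\<nu>\<close> and \<open>K\<^sub>0 = 1\<close>.\<close>

definition fKt :: "('i, 'x, 'y::ab_group_add) super_datum \<Rightarrow> 'i \<Rightarrow> ('i, 'y) falg" where
  "fKt D i = fK (zmul (int (symm D i)) (coroot D i))"

definition fKt' :: "('i, 'x, 'y::ab_group_add) super_datum \<Rightarrow> 'i \<Rightarrow> ('i, 'y) falg" where
  "fKt' D i = fK (- zmul (int (symm D i)) (coroot D i))"

definition fJt :: "('i, 'x, 'y::ab_group_add) super_datum \<Rightarrow> 'i \<Rightarrow> ('i, 'y) falg" where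
  "fJt D i = fJ (zmul (int (symm D i)) (coroot D i))"

definition serre :: "('i, 'x, 'y) super_datum \<Rightarrow> ('i \<Rightarrow> ('i, 'y) falg) \<Rightarrow> 'i \<Rightarrow> 'i \<Rightarrow> ('i, 'y) falg"
  where
  "serre D X i j = (let b = nat (1 - cartan D i j) in
     \<Sum>k = 0..b. scal ((- 1) ^ k * pivar ^ ((k choose 2) * par D i + k * par D i * par D j)
                        * q_binom D i b k) * X i ^ (b - k) * X j * X i ^ k)"

text \<open>An element \<open>u - v\<close> of this set stands for the defining relation \<open>u = v\<close>.\<close>

definition relators :: "('i, 'x, 'y::ab_group_add) super_datum \<Rightarrow> ('i, 'y) falg set" where
  "relators D =
     {fJ \<mu> * fJ \<nu> - fJ (\<mu> + \<nu>) | \<mu> \<nu>. True} \<union>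
     {fK \<mu> * fK \<nu> - fK (\<mu> + \<nu>) | \<mu> \<nu>. True} \<union>
     {fK 0 - 1, fJ 0 - 1} \<union>
     {fJ \<nu> ^ 2 - 1 | \<nu>. True} \<union>
     {fJ \<mu> * fK \<nu> - fK \<nu> * fJ \<mu> | \<mu> \<nu>. True} \<union>
     {fJ \<mu> * fE i - scal (pivar powi pairing D \<mu> (root D i)) * fE i * fJ \<mu> | \<mu> i. True} \<union>
     {fJ \<mu> * fF i - scal (pivar powi (- pairing D \<mu> (root D i))) * fF i * fJ \<mu> | \<mu> i. True} \<union>
     {fK \<mu> * fE i - scal (qvar powi pairing D \<mu> (root D i)) * fE i * fK \<mu> | \<mu> i. True} \<union>
     {fK \<mu> * fF i - scal (qvar powi (- pairing D \<mu> (root D i))) * fF i * fK \<mu> | \<mu> i. True} \<union>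
     {fE i * fF j - scal (pivar ^ (par D i * par D j)) * fF j * fE i
        - (if i = j then scal (1 / q_den D i) * (fJt D i * fKt D i - fKt' D i) else 0) | i j. True} \<union>
     {serre D fE i j | i j. i \<noteq> j} \<union>
     {serre D fF i j | i j. i \<noteq> j}"

definition rel_ideal :: "('i, 'x, 'y::ab_group_add) super_datum \<Rightarrow> ('i, 'y) falg set" where
  "rel_ideal D = Idl\<^bsub>free_alg_ring\<^esub> (relators D)"

text \<open>The class in \<open>U\<close> of an element of the free algebra.\<close>

definition cls :: "('i, 'x, 'y::ab_group_add) super_datum \<Rightarrow> ('i, 'y) falg \<Rightarrow> ('i, 'y) falg set" where
  "cls D x = rel_ideal D +>\<^bsub>free_alg_ring\<^esub> x"

definition U :: "('i, 'x, 'y::ab_group_add) super_datum \<Rightarrow> (qpi, ('i, 'y) falg set) module" where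
  "U D = ring.extend (free_alg_ring Quot rel_ideal D)
           (module.fields (\<lambda>c X. rcoset_mult free_alg_ring (rel_ideal D) (cls D (scal c)) X))"

lemma ideal_rel_ideal: "ideal (rel_ideal D) free_alg_ring"
  unfolding rel_ideal_def
  by (rule ring.genideal_ideal[OF ring_free_alg]) (simp add: free_alg_ring_def)

lemma ring_extend:
  assumes "ring R" shows "ring (ring.extend R m)"
proof -
  interpret ring R by fact
  have c: "carrier (ring.extend R m) = carrier R" "mult (ring.extend R m) = mult R"
    "add (ring.extend R m) = add R" "one (ring.extend R m) = one R" "zero (ring.extend R m) = zero R"
    by (simp_all add: ring.defs)
  show ?thesis
  proof (rule ringI)
    show "abelian_group (ring.extend R m)"
    proof (rule abelian_groupI)
      fix x assume "x \<in> carrier (ring.extend R m)"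
      then show "\<exists>y\<in>carrier (ring.extend R m).
          y \<oplus>\<^bsub>ring.extend R m\<^esub> x = \<zero>\<^bsub>ring.extend R m\<^esub>"
        by (intro bexI[of _ "\<ominus>\<^bsub>R\<^esub> x"]) (simp_all add: c l_neg)
    qed (simp_all add: c a_ac)
    show "monoid (ring.extend R m)"
      by (rule monoidI) (auto simp: c m_assoc)
  qed (auto simp: c l_distr r_distr)
qed

lemma ring_U: "ring (U D)"
  unfolding U_def by (intro ring_extend ideal.quotient_is_ring ideal_rel_ideal)

lemma carrier_U: "carrier (U D) = range (cls D)"
  by (auto simp: U_def ring.defs FactRing_def A_RCOSETS_def' cls_def free_alg_ring_def)

lemma cls_ring_hom: "cls D \<in> ring_hom free_alg_ring (U D)"
proof -
  interpret ideal "rel_ideal D" free_alg_ring by (rule ideal_rel_ideal)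
  have "(\<lambda>x. rel_ideal D +>\<^bsub>free_alg_ring\<^esub> x) \<in> ring_hom free_alg_ring (free_alg_ring Quot rel_ideal D)"
    by (rule rcos_ring_hom)
  then show ?thesis
    by (auto simp: ring_hom_def U_def ring.defs cls_def[abs_def])
qed

lemma smult_U: "c \<odot>\<^bsub>U D\<^esub> cls D x = cls D (scal c * x)"
  using cls_ring_hom[of D]
  by (simp add: ring_hom_def U_def ring.defs module.defs FactRing_def free_alg_ring_def)

lemma cls_eq_iff: "cls D x = cls D y \<longleftrightarrow> x - y \<in> rel_ideal D"
proof -
  interpret ideal "rel_ideal D" free_alg_ring by (rule ideal_rel_ideal)
  have m: "x \<ominus>\<^bsub>free_alg_ring\<^esub> y = x - y"
  proof -
    have "\<ominus>\<^bsub>free_alg_ring\<^esub> y = - y"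
      by (rule add.inv_equality) (simp_all add: free_alg_ring_def)
    then show ?thesis by (simp add: a_minus_def) (simp add: free_alg_ring_def)
  qed
  show ?thesis
    using quotient_eq_iff_same_a_r_cos[OF ideal_axioms, of x y] m
    by (simp add: cls_def) (simp add: free_alg_ring_def)
qed

section \<open>The integral form and the braid operators\<close>

definition is_subalgebra ::
    "qpi set \<Rightarrow> (qpi, 'b, 'm) module_scheme \<Rightarrow> 'b set \<Rightarrow> bool" where
  "is_subalgebra S V H \<longleftrightarrow> subring H V \<and> (\<forall>c\<in>S. \<forall>x\<in>H. c \<odot>\<^bsub>V\<^esub> x \<in> H)"

definition subalgebra_generated ::
    "qpi set \<Rightarrow> (qpi, 'b, 'm) module_scheme \<Rightarrow> 'b set \<Rightarrow> 'b set" where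
  "subalgebra_generated S V G = \<Inter> {H. is_subalgebra S V H \<and> G \<subseteq> H}"

definition algebra_automorphism ::
    "qpi set \<Rightarrow> (qpi, 'b, 'm) module_scheme \<Rightarrow> ('b \<Rightarrow> 'b) \<Rightarrow> bool" where
  "algebra_automorphism S V h \<longleftrightarrow>
     h \<in> ring_iso V V \<and> (\<forall>c\<in>S. \<forall>x\<in>carrier V. h (c \<odot>\<^bsub>V\<^esub> x) = c \<odot>\<^bsub>V\<^esub> h x)"

definition fE_div :: "('i, 'x, 'y) super_datum \<Rightarrow> 'i \<Rightarrow> nat \<Rightarrow> ('i, 'y) falg" where
  "fE_div D i n = scal (1 / q_fact D i n) * fE i ^ n"

definition fF_div :: "('i, 'x, 'y) super_datum \<Rightarrow> 'i \<Rightarrow> nat \<Rightarrow> ('i, 'y) falg" where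
  "fF_div D i n = scal (1 / q_fact D i n) * fF i ^ n"

definition U_int :: "('i, 'x, 'y::ab_group_add) super_datum \<Rightarrow> (qpi, ('i, 'y) falg set) module" where
  "U_int D = (U D)\<lparr>carrier := subalgebra_generated scalarsA (U D)
     ({cls D (fE_div D i n) | i n. True} \<union> {cls D (fF_div D i n) | i n. True} \<union>
      {cls D (fJ \<nu>) | \<nu>. True} \<union> {cls D (fK \<nu>) | \<nu>. True})\<rparr>"

definition int_choose2 :: "int \<Rightarrow> int" where
  "int_choose2 a = a * (a - 1) div 2"

definition braid_E :: "('i, 'x, 'y::ab_group_add) super_datum \<Rightarrow> 'i \<Rightarrow> 'i \<Rightarrow> ('i, 'y) falg" where
  "braid_E D i j =
     scal (pi_at D i powi int_choose2 (cartan D i j)) * fJt D i ^ par D j *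
     (\<Sum>(r, s) \<in> {(r, s). int r + int s = - cartan D i j}.
        scal ((- 1) ^ r * pi_at D i ^ (r * par D i * par D j + (r choose 2) * par D i)
              * (pi_at D i * q_at D i) ^ r)
        * fE_div D i r * fE j * fE_div D i s)"

definition braid_F :: "('i, 'x, 'y::ab_group_add) super_datum \<Rightarrow> 'i \<Rightarrow> 'i \<Rightarrow> ('i, 'y) falg" where
  "braid_F D i j =
     fJt D i ^ par D j *
     (\<Sum>(r, s) \<in> {(r, s). int r + int s = - cartan D i j}.
        scal ((- 1) ^ r * pi_at D i ^ (r * par D i * par D j + (r choose 2) * par D i)
              * inverse (q_at D i) ^ r)
        * fF_div D i s * fF j * fF_div D i r)"

text \<open>These values on the generators determine the automorphism \<open>T\<close> on \<open>carrier (U D)\<close>.\<close>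

definition is_braid_automorphism :: "('i, 'x, 'y::ab_group_add) super_datum \<Rightarrow> 'i \<Rightarrow>
    (('i, 'y) falg set \<Rightarrow> ('i, 'y) falg set) \<Rightarrow> bool" where
  "is_braid_automorphism D i T \<longleftrightarrow>
     algebra_automorphism UNIV (U D) T \<and>
     T (cls D (fE i)) = cls D (- scal (pi_at D i) * fJt D i * fKt D i * fF i) \<and>
     T (cls D (fF i)) = cls D (- fE i * fKt' D i) \<and>
     (\<forall>\<mu>. T (cls D (fK \<mu>)) = cls D (fK (reflect D i \<mu>))) \<and>
     (\<forall>\<mu>. T (cls D (fJ \<mu>)) = cls D (fJ (reflect D i \<mu>))) \<and>
     (\<forall>j. j \<noteq> i \<longrightarrow> T (cls D (fE j)) = cls D (braid_E D i j) \<and>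
                    T (cls D (fF j)) = cls D (braid_F D i j))"

end

theory Submission
  imports Defs
begin

text \<open>For \<open>j \<noteq> i\<close> put \<open>m = - a\<^sub>i\<^sub>j\<close>. Up to a unit, \<open>T (E\<^sub>j)\<close> is \<open>J\<close> to the power \<open>p(j)\<close> times
  \<open>D\<^sup>m(E\<^sub>j) / [m]!\<close>, where \<open>D\<close> is the skew commutator with \<open>E\<^sub>i\<close>, and the Serre relation says
  \<open>D\<^sup>m\<^sup>+\<^sup>1(E\<^sub>j) = 0\<close>. In the Leibniz rule for \<open>D\<close> iterated \<open>n m\<close> times on \<open>E\<^sub>j\<^sup>n\<close> only one term
  survives, so the \<open>n\<close>-th power of \<open>D\<^sup>m(E\<^sub>j) / [m]!\<close> is a unit times the divided iterate of \<open>E\<^sub>j\<^sup>n\<close>;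
  expanding the latter in divided powers of \<open>E\<^sub>i\<close> shows that \<open>T\<close> maps divided powers of \<open>E\<^sub>j\<close> to the
  integral form. Conversely, \<open>E\<^sub>j, D(E\<^sub>j), \<dots>, D\<^sup>m(E\<^sub>j)\<close> behave like the weight vectors of a simple
  \<open>sl\<^sub>2\<close>-module, so skew commutators with (essentially) \<open>T (E\<^sub>i)\<close> lead back from the highest vector
  to \<open>E\<^sub>j\<close>. The same Leibniz argument then writes divided powers of \<open>E\<^sub>j\<close> as integral
  expressions in the images under \<open>T\<close> of the divided powers of \<open>E\<^sub>i\<close> and \<open>E\<^sub>j\<close>, whence the image of
  the integral form is the whole integral form. The \<open>F\<^sub>j\<close> are treated in the same way.\<close>

section \<open>Gaussian binomial coefficients\<close>

lemma Suc_choose_two: "Suc n choose 2 = n + (n choose 2)"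
  by (simp add: numeral_2_eq_2)

lemma zero_choose_two [simp]: "0 choose 2 = 0"
  by (simp add: numeral_2_eq_2)

lemma choose_two_add: "(a + b) choose 2 = (a choose 2) + (b choose 2) + a * b"
  by (induction a) (simp_all add: Suc_choose_two)

lemma two_times_choose_two: "2 * (a choose 2) + a = a * a"
  by (induction a) (simp_all add: Suc_choose_two)

text \<open>The one-sided Gaussian numbers (v^n - 1)/(v - 1), written without division so that they
  make sense over any commutative ring. For v = \<pi>_i q_i^2 they are the [n]_i up to a power of
  q_i; see \<open>q_fact_gauss\<close>.\<close>

definition gauss_int :: "'k::comm_ring_1 \<Rightarrow> nat \<Rightarrow> 'k" where
  "gauss_int v n = (\<Sum>k<n. v ^ k)"

primrec gauss_fact :: "'k::comm_ring_1 \<Rightarrow> nat \<Rightarrow> 'k" where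
  "gauss_fact v 0 = 1"
| "gauss_fact v (Suc n) = gauss_int v (Suc n) * gauss_fact v n"

fun gauss_binom :: "'k::comm_ring_1 \<Rightarrow> nat \<Rightarrow> nat \<Rightarrow> 'k" where
  "gauss_binom v n 0 = 1"
| "gauss_binom v 0 (Suc k) = 0"
| "gauss_binom v (Suc n) (Suc k) = gauss_binom v n k + v ^ Suc k * gauss_binom v n (Suc k)"

lemma gauss_int_0 [simp]: "gauss_int v 0 = 0"
  by (simp add: gauss_int_def)

lemma gauss_int_Suc: "gauss_int v (Suc n) = gauss_int v n + v ^ n"
  by (simp add: gauss_int_def)

lemma gauss_int_add: "gauss_int v (m + n) = gauss_int v m + v ^ m * gauss_int v n"
  by (induction n) (simp_all add: gauss_int_Suc power_add algebra_simps)

lemma gauss_int_mult: "(v - 1) * gauss_int v n = v ^ n - 1"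
  by (induction n) (simp_all add: gauss_int_Suc algebra_simps)

lemma gauss_binom_eq_0: "n < k \<Longrightarrow> gauss_binom v n k = 0"
  by (induction v n k rule: gauss_binom.induct) auto

lemma gauss_binom_self [simp]: "gauss_binom v n n = 1"
  by (induction n) (auto simp: gauss_binom_eq_0)

text \<open>Both Pascal summands contribute a multiple of [n]!, and the multiples [k+1] and v^(k+1)
  [n-k] add up to [n+1].\<close>

lemma gauss_binom_fact:
  "k \<le> n \<Longrightarrow> gauss_binom v n k * gauss_fact v k * gauss_fact v (n - k) = gauss_fact v n"
proof (induction v n k rule: gauss_binom.induct)
  case (3 v n k)
  show ?case
  proof (cases "k = n")
    case False
    then have k: "Suc k \<le> n" using 3 by simp
    then have d: "n - k = Suc (n - Suc k)" by simp
    have "gauss_binom v (Suc n) (Suc k) * gauss_fact v (Suc k) * gauss_fact v (n - k)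
      = gauss_int v (Suc k) * (gauss_binom v n k * gauss_fact v k * gauss_fact v (n - k))
      + v ^ Suc k * gauss_int v (n - k)
         * (gauss_binom v n (Suc k) * gauss_fact v (Suc k) * gauss_fact v (n - Suc k))"
      unfolding d by (simp add: algebra_simps)
    also have "\<dots> = (gauss_int v (Suc k) + v ^ Suc k * gauss_int v (n - k)) * gauss_fact v n"
      using 3 k by (simp add: algebra_simps)
    also have "\<dots> = gauss_int v (Suc n) * gauss_fact v n"
      using gauss_int_add[of v "Suc k" "n - k"] k by simp
    finally show ?thesis by simp
  qed (simp add: gauss_binom_eq_0)
qed auto

text \<open>The Leibniz rule uses the defining recursion, the expansion of iterated commutators this
  mirror form. Unfolding the recursion once reduces it to smaller n, for k and for k - 1.\<close>

lemma gauss_binom_Suc_Suc':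
  "k \<le> n \<Longrightarrow> gauss_binom v (Suc n) (Suc k) = gauss_binom v n (Suc k) + v ^ (n - k) * gauss_binom v n k"
proof (induction n arbitrary: k)
  case (Suc n)
  show ?case
  proof (cases "k = Suc n")
    case True
    then show ?thesis by (simp add: gauss_binom_eq_0)
  next
    case False
    then have k: "k \<le> n" using Suc by simp
    show ?thesis
    proof (cases k)
      case 0
      then show ?thesis using Suc.IH[of 0] by (simp add: algebra_simps)
    next
      case (Suc l)
      have e: "v ^ (n - l) * gauss_binom v n l + v ^ Suc k * v ^ (n - k) * gauss_binom v n k
        = v ^ (Suc n - k) * gauss_binom v (Suc n) k"
      proof -
        have "Suc k + (n - k) = (Suc n - k) + k" using k by simp
        then have "v ^ Suc k * v ^ (n - k) = v ^ (Suc n - k) * v ^ k"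
          by (simp only: flip: power_add)
        moreover have "Suc n - k = n - l" using Suc by simp
        ultimately show ?thesis using Suc by (simp add: algebra_simps)
      qed
      have "gauss_binom v (Suc (Suc n)) (Suc k)
        = gauss_binom v (Suc n) k + v ^ Suc k * gauss_binom v (Suc n) (Suc k)" by simp
      also have "\<dots> = gauss_binom v n k + v ^ (n - l) * gauss_binom v n l
          + v ^ Suc k * (gauss_binom v n (Suc k) + v ^ (n - k) * gauss_binom v n k)"
        using Suc.IH[of k] Suc.IH[of l] k Suc by simp
      also have "\<dots> = gauss_binom v (Suc n) (Suc k) + v ^ (Suc n - k) * gauss_binom v (Suc n) k"
        unfolding e[symmetric] by (simp add: algebra_simps)
      finally show ?thesis .
    qed
  qed
qed simp

text \<open>Passing to the inverse base changes a single factor by a power only: v^(n-1) [n]_w =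
  [n]_v. The way down from the highest vector uses base \<open>w\<close>.\<close>

lemma gauss_fact_inverse_base:
  assumes "v * w = 1"
  shows "v ^ (n choose 2) * gauss_fact w n = gauss_fact v n"
proof (induction n)
  case (Suc n)
  have i: "v ^ n * gauss_int w (Suc n) = gauss_int v (Suc n)" for n
  proof (induction n)
    case (Suc n)
    have "v ^ Suc n * gauss_int w (Suc (Suc n))
      = v * (v ^ n * gauss_int w (Suc n)) + (v * w) ^ Suc n"
      by (simp add: gauss_int_Suc[of w "Suc n"] power_mult_distrib algebra_simps)
    also have "\<dots> = gauss_int v (Suc (Suc n))"
      using gauss_int_add[of v 1 "Suc n"] unfolding Suc assms by (simp add: gauss_int_Suc)
    finally show ?case .
  qed (simp add: gauss_int_Suc)
  have "v ^ (Suc n choose 2) * gauss_fact w (Suc n)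
    = (v ^ n * gauss_int w (Suc n)) * (v ^ (n choose 2) * gauss_fact w n)"
    by (simp add: Suc_choose_two power_add algebra_simps)
  then show ?case by (simp add: i Suc)
qed simp

section \<open>Iterated skew commutators\<close>

locale scalar_algebra =
  fixes sc :: "'k::comm_ring_1 \<Rightarrow> 'a::ring_1 \<Rightarrow> 'a"
  assumes sc_add_right [simp]: "sc a (x + y) = sc a x + sc a y"
    and sc_add_left: "sc (a + b) x = sc a x + sc b x"
    and sc_sc [simp]: "sc a (sc b x) = sc (a * b) x"
    and sc_one [simp]: "sc 1 x = x"
    and sc_mult_left [simp]: "sc a x * y = sc a (x * y)"
    and sc_mult_right [simp]: "x * sc a y = sc a (x * y)"
begin

sublocale scm: Modules.module sc
  by unfold_locales (simp_all add: sc_add_left)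

lemma sc_power: "sc a x ^ n = sc (a ^ n) (x ^ n)"
  by (induction n) (simp_all add: algebra_simps)

text \<open>\<open>c\<close> is the twist of the first commutator. Each step adds one factor
  \<open>e\<close>, which multiplies the twist by \<open>v\<close>; hence the twist v^n c in step n
  + 1.\<close>

primrec skew :: "'k \<Rightarrow> 'a \<Rightarrow> nat \<Rightarrow> 'k \<Rightarrow> 'a \<Rightarrow> 'a" where
  "skew v e 0 c x = x"
| "skew v e (Suc n) c x = e * skew v e n c x - sc (v ^ n * c) (skew v e n c x * e)"

lemma skew_scale: "skew v e n c (sc a x) = sc a (skew v e n c x)"
  by (induction n) (simp_all add: scm.scale_right_diff_distrib mult.commute mult.left_commute)

text \<open>The monomial with r + 1 factors \<open>e\<close> on the right arises once from left and
  once from right multiplication by \<open>e\<close>; the mirror Pascal rule adds the two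
  coefficients.\<close>

lemma skew_expand:
  "skew v e n c x =
    (\<Sum>r\<le>n. sc ((- 1) ^ r * v ^ (r choose 2) * c ^ r * gauss_binom v n r) (e ^ (n - r) * x * e ^ r))"
proof (induction n)
  case (Suc n)
  let ?t = "\<lambda>r. sc ((- 1) ^ r * v ^ (r choose 2) * c ^ r * gauss_binom v n r)"
  let ?m = "\<lambda>r. e ^ (Suc n - r) * x * e ^ r"
  have "e * skew v e n c x = (\<Sum>r\<le>n. ?t r (?m r))"
    unfolding Suc by (simp add: sum_distrib_left Suc_diff_le mult.assoc)
  also have "\<dots> = (\<Sum>r\<le>Suc n. ?t r (?m r))"
    by (simp add: gauss_binom_eq_0)
  also have "\<dots> = ?m 0 + (\<Sum>r\<le>n. ?t (Suc r) (?m (Suc r)))"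
    by (simp add: sum.atMost_Suc_shift del: sum.atMost_Suc)
  finally have 1: "e * skew v e n c x = ?m 0 + (\<Sum>r\<le>n. ?t (Suc r) (?m (Suc r)))" .
  have 2: "sc (v ^ n * c) (skew v e n c x * e)
    = (\<Sum>r\<le>n. sc (v ^ n * c * ((- 1) ^ r * v ^ (r choose 2) * c ^ r * gauss_binom v n r)) (?m (Suc r)))"
    unfolding Suc
    by (simp add: sum_distrib_right scm.scale_sum_right mult.assoc power_commutes)
  have 3: "?t (Suc r) (?m (Suc r))
      - sc (v ^ n * c * ((- 1) ^ r * v ^ (r choose 2) * c ^ r * gauss_binom v n r)) (?m (Suc r))
    = sc ((- 1) ^ Suc r * v ^ (Suc r choose 2) * c ^ Suc r * gauss_binom v (Suc n) (Suc r)) (?m (Suc r))"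
    if "r \<le> n" for r
  proof -
    have "v ^ n = v ^ r * v ^ (n - r)" using that by (simp flip: power_add)
    then have "(- 1) ^ Suc r * v ^ (Suc r choose 2) * c ^ Suc r * gauss_binom v n (Suc r)
      - v ^ n * c * ((- 1) ^ r * v ^ (r choose 2) * c ^ r * gauss_binom v n r)
      = (- 1) ^ Suc r * v ^ (Suc r choose 2) * c ^ Suc r * gauss_binom v (Suc n) (Suc r)"
      using gauss_binom_Suc_Suc'[OF that, of v]
      by (simp add: Suc_choose_two power_add algebra_simps del: gauss_binom.simps)
    then show ?thesis by (simp only: flip: scm.scale_left_diff_distrib)
  qed
  have "skew v e (Suc n) c x = ?m 0 + (\<Sum>r\<le>n. ?t (Suc r) (?m (Suc r))
      - sc (v ^ n * c * ((- 1) ^ r * v ^ (r choose 2) * c ^ r * gauss_binom v n r)) (?m (Suc r)))"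
    by (simp add: 1 2 sum_subtractf)
  also have "\<dots> = ?m 0 + (\<Sum>r\<le>n. sc ((- 1) ^ Suc r * v ^ (Suc r choose 2) * c ^ Suc r
      * gauss_binom v (Suc n) (Suc r)) (?m (Suc r)))"
    by (intro arg_cong2[where f = "(+)"] refl sum.cong 3) simp
  also have "\<dots> = (\<Sum>r\<le>Suc n. sc ((- 1) ^ r * v ^ (r choose 2) * c ^ r * gauss_binom v (Suc n) r) (?m r))"
    by (simp add: sum.atMost_Suc_shift del: sum.atMost_Suc gauss_binom.simps(3))
  finally show ?case .
qed simp

text \<open>A quantum Leibniz rule: twists multiply when factors do, and the defining Pascal
  recursion produces the binomials.\<close>

lemma skew_mult:
  "skew v e n (c * c') (x * y) =
    (\<Sum>a\<le>n. sc (gauss_binom v n a * c ^ (n - a)) (skew v e a c x * skew v e (n - a) c' y))"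
proof (induction n)
  case (Suc n)
  let ?X = "\<lambda>a. skew v e a c x" and ?Y = "\<lambda>a. skew v e a c' y"
  \<comment> \<open>Insert v^a c X_a e Y_b with both signs: one commutator acts on the left factor,
    the other on the right factor.\<close>
  have step: "e * (?X a * ?Y b) - sc (v ^ (a + b) * (c * c')) (?X a * ?Y b * e)
    = ?X (Suc a) * ?Y b + sc (v ^ a * c) (?X a * ?Y (Suc b))" for a b
    by (simp add: algebra_simps power_add)
  have "skew v e (Suc n) (c * c') (x * y)
    = (\<Sum>a\<le>n. sc (gauss_binom v n a * c ^ (n - a))
        (e * (?X a * ?Y (n - a)) - sc (v ^ (a + (n - a)) * (c * c')) (?X a * ?Y (n - a) * e)))"
    by (simp add: Suc sum_distrib_left sum_distrib_right scm.scale_sum_right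
        scm.scale_right_diff_distrib mult_ac flip: sum_subtractf)
  also have "\<dots> = (\<Sum>a\<le>n. sc (gauss_binom v n a * c ^ (n - a)) (?X (Suc a) * ?Y (n - a)))
    + (\<Sum>a\<le>n. sc (v ^ a * gauss_binom v n a * c ^ (Suc n - a)) (?X a * ?Y (Suc n - a)))"
    unfolding step sum.distrib[symmetric]
    by (rule sum.cong) (simp_all add: Suc_diff_le mult_ac del: skew.simps)
  also have "(\<Sum>a\<le>n. sc (v ^ a * gauss_binom v n a * c ^ (Suc n - a)) (?X a * ?Y (Suc n - a)))
    = (\<Sum>a\<le>Suc n. sc (v ^ a * gauss_binom v n a * c ^ (Suc n - a)) (?X a * ?Y (Suc n - a)))"
    by (simp add: gauss_binom_eq_0)
  also have "\<dots> = sc (c ^ Suc n) (?X 0 * ?Y (Suc n))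
    + (\<Sum>a\<le>n. sc (v ^ Suc a * gauss_binom v n (Suc a) * c ^ (n - a)) (?X (Suc a) * ?Y (n - a)))"
    by (simp add: sum.atMost_Suc_shift del: sum.atMost_Suc skew.simps)
  finally have "skew v e (Suc n) (c * c') (x * y) = sc (c ^ Suc n) (?X 0 * ?Y (Suc n))
    + (\<Sum>a\<le>n. sc (gauss_binom v (Suc n) (Suc a) * c ^ (n - a)) (?X (Suc a) * ?Y (n - a)))"
    by (simp add: sum.distrib sc_add_left algebra_simps del: skew.simps)
  also have "\<dots> = (\<Sum>a\<le>Suc n. sc (gauss_binom v (Suc n) a * c ^ (Suc n - a)) (?X a * ?Y (Suc n - a)))"
    by (simp add: sum.atMost_Suc_shift del: sum.atMost_Suc skew.simps gauss_binom.simps(3))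
  finally show ?case .
qed simp

end

section \<open>Integral forms\<close>

text \<open>Computations take place in the free algebra modulo \<open>I\<close>, because the
  elements of the quotient are cosets and not the values of a ring type. \<open>B\<close> stands for
  the full preimage of an integral subalgebra, so it contains \<open>I\<close>.\<close>

locale integral_form = scalar_algebra sc
  for sc :: "'k::comm_ring_1 \<Rightarrow> 'a::ring_1 \<Rightarrow> 'a" +
  fixes I B :: "'a set"
  assumes I_zero: "0 \<in> I"
    and I_add: "x \<in> I \<Longrightarrow> y \<in> I \<Longrightarrow> x + y \<in> I"
    and I_left: "x \<in> I \<Longrightarrow> y * x \<in> I"
    and I_right: "x \<in> I \<Longrightarrow> x * y \<in> I"
    and B_one: "1 \<in> B"
    and B_add: "x \<in> B \<Longrightarrow> y \<in> B \<Longrightarrow> x + y \<in> B"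
    and B_uminus: "x \<in> B \<Longrightarrow> - x \<in> B"
    and B_mult: "x \<in> B \<Longrightarrow> y \<in> B \<Longrightarrow> x * y \<in> B"
    and I_subset_B: "I \<subseteq> B"
begin

definition eqv :: "'a \<Rightarrow> 'a \<Rightarrow> bool" (infix "\<approx>" 50) where
  "x \<approx> y \<longleftrightarrow> x - y \<in> I"

text \<open>As \<open>B\<close> is closed under products, testing a scalar on 1 decides whether it
  preserves \<open>B\<close>.\<close>

definition int_scalars :: "'k set" where
  "int_scalars = {a. sc a 1 \<in> B}"

lemma I_uminus: "x \<in> I \<Longrightarrow> - x \<in> I"
  using I_left[of x "- 1"] by simp

lemma I_diff: "x \<in> I \<Longrightarrow> y \<in> I \<Longrightarrow> x - y \<in> I"
  using I_add[of x "- y"] I_uminus[of y] by simp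

lemma I_sc: "x \<in> I \<Longrightarrow> sc a x \<in> I"
  using I_left[of x "sc a 1"] by simp

lemma I_sum: "(\<And>a. a \<in> A \<Longrightarrow> g a \<in> I) \<Longrightarrow> sum g A \<in> I"
  by (induction A rule: infinite_finite_induct) (auto intro: I_zero I_add)

lemma eqv_refl [simp]: "x \<approx> x"
  by (simp add: eqv_def I_zero)

lemma eqv_sym: "x \<approx> y \<Longrightarrow> y \<approx> x"
  using I_uminus[of "x - y"] by (simp add: eqv_def)

lemma eqv_trans [trans]: "x \<approx> y \<Longrightarrow> y \<approx> z \<Longrightarrow> x \<approx> z"
  using I_add[of "x - y" "y - z"] by (simp add: eqv_def)

lemma eq_eqv_trans [trans]: "x = y \<Longrightarrow> y \<approx> z \<Longrightarrow> x \<approx> z"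
  by simp

lemma eqv_eq_trans [trans]: "x \<approx> y \<Longrightarrow> y = z \<Longrightarrow> x \<approx> z"
  by simp

lemma eqv_add: "x \<approx> x' \<Longrightarrow> y \<approx> y' \<Longrightarrow> x + y \<approx> x' + y'"
  using I_add[of "x - x'" "y - y'"] by (simp add: eqv_def algebra_simps)

lemma eqv_diff: "x \<approx> x' \<Longrightarrow> y \<approx> y' \<Longrightarrow> x - y \<approx> x' - y'"
  using I_diff[of "x - x'" "y - y'"] by (simp add: eqv_def algebra_simps)

lemma eqv_mult: "x \<approx> x' \<Longrightarrow> y \<approx> y' \<Longrightarrow> x * y \<approx> x' * y'"
  using I_add[OF I_right[of "x - x'" y] I_left[of "y - y'" x']]
  by (simp add: eqv_def algebra_simps)

lemma eqv_sc: "x \<approx> y \<Longrightarrow> sc a x \<approx> sc a y"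
  using I_sc[of "x - y" a] by (simp add: eqv_def scm.scale_right_diff_distrib)

lemma eqv_power: "x \<approx> y \<Longrightarrow> x ^ n \<approx> y ^ n"
  by (induction n) (auto intro: eqv_mult)

lemma eqv_I: "x \<in> I \<Longrightarrow> x \<approx> 0"
  by (simp add: eqv_def)

lemma I_eqv: "x \<approx> y \<Longrightarrow> y \<in> I \<Longrightarrow> x \<in> I"
  using I_add[of "x - y" y] by (simp add: eqv_def)

lemma B_eqv: "x \<approx> y \<Longrightarrow> y \<in> B \<Longrightarrow> x \<in> B"
  using B_add[of "x - y" y] I_subset_B by (auto simp: eqv_def)

lemma B_sc: "a \<in> int_scalars \<Longrightarrow> x \<in> B \<Longrightarrow> sc a x \<in> B"
  using B_mult[of "sc a 1" x] by (simp add: int_scalars_def)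

lemma B_sum: "(\<And>a. a \<in> A \<Longrightarrow> g a \<in> B) \<Longrightarrow> sum g A \<in> B"
  using I_zero I_subset_B by (induction A rule: infinite_finite_induct) (auto intro: B_add)

lemma B_power: "x \<in> B \<Longrightarrow> x ^ n \<in> B"
  by (induction n) (auto intro: B_one B_mult)

lemma int_scalars_one: "1 \<in> int_scalars"
  by (simp add: int_scalars_def B_one)

lemma int_scalars_uminus: "a \<in> int_scalars \<Longrightarrow> - a \<in> int_scalars"
  using B_uminus[of "sc a 1"] by (simp add: int_scalars_def)

lemma int_scalars_mult: "a \<in> int_scalars \<Longrightarrow> b \<in> int_scalars \<Longrightarrow> a * b \<in> int_scalars"
  using B_sc[of a "sc b 1"] by (simp add: int_scalars_def)

lemma int_scalars_power: "a \<in> int_scalars \<Longrightarrow> a ^ n \<in> int_scalars"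
  by (induction n) (auto intro: int_scalars_one int_scalars_mult)

lemma int_scalars_prod: "(\<And>j. j \<in> A \<Longrightarrow> g j \<in> int_scalars) \<Longrightarrow> prod g A \<in> int_scalars"
  by (induction A rule: infinite_finite_induct) (auto intro: int_scalars_one int_scalars_mult)

lemmas int_scalars_intros =
  int_scalars_one int_scalars_uminus int_scalars_mult int_scalars_power int_scalars_prod

section \<open>Commutation up to scalars and powers of products\<close>

lemma commute_power: "x * y \<approx> sc b (y * x) \<Longrightarrow> x ^ n * y \<approx> sc (b ^ n) (y * x ^ n)"
proof (induction n)
  case (Suc n)
  have "x ^ Suc n * y = x * (x ^ n * y)" by (simp add: mult.assoc)
  also have "\<dots> \<approx> x * sc (b ^ n) (y * x ^ n)" by (intro eqv_mult eqv_refl Suc)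
  also have "\<dots> = sc (b ^ n) ((x * y) * x ^ n)" by (simp add: mult.assoc)
  also have "\<dots> \<approx> sc (b ^ n) (sc b (y * x) * x ^ n)" by (intro eqv_sc eqv_mult eqv_refl Suc)
  also have "\<dots> = sc (b ^ Suc n) (y * x ^ Suc n)" by (simp add: mult.assoc mult.commute)
  finally show ?case .
qed simp

text \<open>The exponent is n choose 2, but later it only matters that the factor is a power of
  \<open>b\<close> and hence integral when \<open>b\<close> is.\<close>

lemma power_mult_commute:
  assumes yx: "y * x \<approx> sc b (x * y)"
  shows "\<exists>k. (x * y) ^ n \<approx> sc (b ^ k) (x ^ n * y ^ n)"
proof (induction n)
  case (Suc n)
  obtain k where k: "(x * y) ^ n \<approx> sc (b ^ k) (x ^ n * y ^ n)" using Suc by blast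
  have "(x * y) ^ Suc n = (x * y) ^ n * (x * y)" by (rule power_Suc2)
  also have "\<dots> \<approx> sc (b ^ k) (x ^ n * y ^ n) * (x * y)" by (intro eqv_mult eqv_refl k)
  also have "\<dots> = sc (b ^ k) (x ^ n * (y ^ n * x) * y)" by (simp add: mult.assoc)
  also have "\<dots> \<approx> sc (b ^ k) (x ^ n * sc (b ^ n) (x * y ^ n) * y)"
    by (intro eqv_sc eqv_mult eqv_refl commute_power yx)
  also have "\<dots> = sc (b ^ (k + n)) ((x ^ n * x) * (y ^ n * y))"
    by (simp add: mult.assoc power_add)
  also have "\<dots> = sc (b ^ (k + n)) (x ^ Suc n * y ^ Suc n)"
    by (simp only: power_Suc2)
  finally show ?case by blast
qed (auto intro!: exI[of _ 0])

text \<open>Sorting the factors of z^n costs only an integral scalar. With \<open>a\<close> the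
  inverse of a quantum factorial, a divided power of \<open>z\<close> reduces to a divided power of
  one factor and an ordinary power of the other.\<close>

lemma product_power_integral:
  assumes z: "z \<approx> sc u (x * y)" and yx: "y * x \<approx> sc b (x * y)"
    and S: "u \<in> int_scalars" "b \<in> int_scalars" and B: "sc a (x ^ n * y ^ n) \<in> B"
  shows "sc a (z ^ n) \<in> B"
proof -
  obtain k where k: "(x * y) ^ n \<approx> sc (b ^ k) (x ^ n * y ^ n)"
    using power_mult_commute[OF yx] by blast
  have "sc a (z ^ n) \<approx> sc a (sc u (x * y) ^ n)" by (intro eqv_sc eqv_power z)
  also have "\<dots> = sc (a * u ^ n) ((x * y) ^ n)" by (simp add: sc_power)
  also have "\<dots> \<approx> sc (a * u ^ n) (sc (b ^ k) (x ^ n * y ^ n))" by (intro eqv_sc k)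
  also have "\<dots> = sc (u ^ n * b ^ k) (sc a (x ^ n * y ^ n))" by (simp add: mult_ac)
  finally show ?thesis by (rule B_eqv) (intro B_sc[OF _ B] int_scalars_intros S)
qed

lemma commute_inverse:
  assumes "x * y \<approx> sc a (y * x)" "a * b = 1"
  shows "y * x \<approx> sc b (x * y)"
  using eqv_sym[OF eqv_sc[OF assms(1), of b]] assms(2) by (simp add: mult.commute)

lemma commute_mult:
  assumes "x * z \<approx> sc a (z * x)" "y * z \<approx> sc b (z * y)"
  shows "(x * y) * z \<approx> sc (a * b) (z * (x * y))"
proof -
  have "(x * y) * z = x * (y * z)" by (simp add: mult.assoc)
  also have "\<dots> \<approx> x * sc b (z * y)" by (intro eqv_mult eqv_refl assms)
  also have "\<dots> = sc b ((x * z) * y)" by (simp add: mult.assoc)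
  also have "\<dots> \<approx> sc b (sc a (z * x) * y)" by (intro eqv_sc eqv_mult eqv_refl assms)
  also have "\<dots> = sc (a * b) (z * (x * y))" by (simp add: mult.assoc mult.commute)
  finally show ?thesis .
qed

lemma commute_mult_right:
  assumes "x * y \<approx> sc a (y * x)" "x * z \<approx> sc b (z * x)"
  shows "x * (y * z) \<approx> sc (a * b) (y * z * x)"
proof -
  have "x * (y * z) = (x * y) * z" by (simp add: mult.assoc)
  also have "\<dots> \<approx> sc a (y * x) * z" by (intro eqv_mult eqv_refl assms)
  also have "\<dots> = sc a (y * (x * z))" by (simp add: mult.assoc)
  also have "\<dots> \<approx> sc a (y * sc b (z * x))" by (intro eqv_sc eqv_mult eqv_refl assms)
  also have "\<dots> = sc (a * b) (y * z * x)" by (simp add: mult.assoc)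
  finally show ?thesis .
qed

lemma commute_eqv:
  assumes z: "z \<approx> sc u y" and xy: "x * y \<approx> sc a (y * x)"
  shows "x * z \<approx> sc a (z * x)"
proof -
  have "x * z \<approx> x * sc u y" by (intro eqv_mult eqv_refl z)
  also have "\<dots> = sc u (x * y)" by simp
  also have "\<dots> \<approx> sc u (sc a (y * x))" by (intro eqv_sc xy)
  also have "\<dots> = sc a (sc u y * x)" by (simp add: mult.commute)
  also have "\<dots> \<approx> sc a (z * x)" by (intro eqv_sc eqv_mult eqv_refl eqv_sym[OF z])
  finally show ?thesis .
qed

section \<open>Divided iterates of skew commutators\<close>

lemma skew_I_mono:
  assumes "skew v e m c x \<in> I" "m \<le> n"
  shows "skew v e n c x \<in> I"
  using assms(2) by (induction rule: dec_induct) (auto intro: assms I_diff I_left I_right I_sc)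

text \<open>\<open>f n\<close> is the inverse of the Gaussian factorial, so \<open>f n\<close> times
  the binomial is \<open>f (n - r) * f r\<close>: dividing the iterate turns the powers of
  \<open>e\<close> on both sides into divided powers.\<close>

lemma skew_divided_expand:
  assumes f: "\<And>n. f n * gauss_fact v n = 1"
  shows "sc (f n) (skew v e n c x) = (\<Sum>r\<le>n. sc ((- 1) ^ r * v ^ (r choose 2) * c ^ r)
           (sc (f (n - r)) (e ^ (n - r)) * x * sc (f r) (e ^ r)))"
proof -
  have b: "f n * gauss_binom v n r = f (n - r) * f r" if "r \<le> n" for r
  proof -
    have "f n * gauss_binom v n r
      = f n * gauss_binom v n r * (f r * gauss_fact v r) * (f (n - r) * gauss_fact v (n - r))"
      by (simp add: f)
    also have "\<dots> = f n * (gauss_binom v n r * gauss_fact v r * gauss_fact v (n - r)) * f r * f (n - r)"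
      by (simp add: mult_ac)
    finally show ?thesis unfolding gauss_binom_fact[OF that] f by (simp add: mult.commute)
  qed
  have "f n * (a * gauss_binom v n r) = a * (f (n - r) * f r)" if "r \<le> n" for r a
    using b[OF that] by (metis mult.left_commute)
  then show ?thesis
    unfolding skew_expand scm.scale_sum_right
    by (intro sum.cong refl)
      (simp only: sc_sc sc_mult_left sc_mult_right atMost_iff mult.commute[of "f (n - _)"])
qed

text \<open>In the Leibniz expansion of x^n * x the left factor vanishes after n m steps and the
  right one after m. So only the term a = n m survives in degree (n + 1) m, and none beyond it. The
  first claim needs the second for smaller n, so both share one induction. The exponent
  \<open>k\<close> is m times (n choose 2).\<close>

lemma skew_power:
  assumes f: "\<And>n. f n * gauss_fact v n = 1" and van: "skew v e (Suc m) c x \<in> I"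
  shows "\<exists>k. sc (f (n * m)) (skew v e (n * m) (c ^ n) (x ^ n)) \<approx> sc (c ^ k) (sc (f m) (skew v e m c x) ^ n)"
    and "\<And>N. N > n * m \<Longrightarrow> skew v e N (c ^ n) (x ^ n) \<in> I"
proof (induction n)
  case 0
  have "f 0 = 1" using f[of 0] by simp
  {
    case 1
    show ?case using \<open>f 0 = 1\<close> by (intro exI[of _ 0]) simp
  next
    case (2 N)
    \<comment> \<open>The empty product has twist c^0 = 1, and 1 commutes with \<open>e\<close>, so
      already its first skew commutator is zero.\<close>
    have "skew v e 1 1 1 \<in> I" by (simp add: I_zero)
    then have "skew v e N 1 1 \<in> I" by (rule skew_I_mono) (use 2 in simp)
    then show ?case by simp
  }
next
  case (Suc n)
  let ?t = "\<lambda>N a. sc (gauss_binom v N a * (c ^ n) ^ (N - a))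
    (skew v e a (c ^ n) (x ^ n) * skew v e (N - a) c x)"
  have expand: "skew v e N (c ^ Suc n) (x ^ Suc n) = (\<Sum>a\<le>N. ?t N a)" for N
    unfolding power_Suc2 by (rule skew_mult)
  have t: "?t N a \<in> I" if "a > n * m \<or> N - a > m" for N a
    using that
  proof
    assume "a > n * m"
    then show ?thesis by (intro I_sc I_right Suc(2))
  next
    assume "N - a > m"
    then show ?thesis by (intro I_sc I_left skew_I_mono[OF van]) simp
  qed
  {
    case 1
    obtain k where k: "sc (f (n * m)) (skew v e (n * m) (c ^ n) (x ^ n)) \<approx> sc (c ^ k) (sc (f m) (skew v e m c x) ^ n)"
      using Suc(1) by blast
    have N: "n * m \<in> {..Suc n * m}" "Suc n * m - n * m = m" by simp_all
    have "skew v e (Suc n * m) (c ^ Suc n) (x ^ Suc n)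
      = ?t (Suc n * m) (n * m) + (\<Sum>a\<in>{..Suc n * m} - {n * m}. ?t (Suc n * m) a)"
      unfolding expand using N(1) by (rule sum.remove[OF finite_atMost])
    also have "\<dots> \<approx> ?t (Suc n * m) (n * m) + 0"
    proof (intro eqv_add eqv_refl eqv_I I_sum t)
      fix a assume "a \<in> {..Suc n * m} - {n * m}"
      then show "a > n * m \<or> Suc n * m - a > m" by auto
    qed
    finally have "skew v e (Suc n * m) (c ^ Suc n) (x ^ Suc n) \<approx> ?t (Suc n * m) (n * m)"
      by (simp only: add_0_right)
    then have "sc (f (Suc n * m)) (skew v e (Suc n * m) (c ^ Suc n) (x ^ Suc n))
      \<approx> sc (f (Suc n * m)) (?t (Suc n * m) (n * m))" by (rule eqv_sc)
    also have "\<dots> = sc (c ^ (n * m))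
       (sc (f (n * m)) (skew v e (n * m) (c ^ n) (x ^ n)) * sc (f m) (skew v e m c x))"
    proof -
      \<comment> \<open>Insert the products \<open>f * gauss_fact\<close>, equal to 1, for n m and
        for m, so that \<open>gauss_binom_fact\<close> removes the binomial.\<close>
      have "f (Suc n * m) * gauss_binom v (Suc n * m) (n * m) = f (Suc n * m) *
        (gauss_binom v (Suc n * m) (n * m) * gauss_fact v (n * m) * gauss_fact v (Suc n * m - n * m))
        * f (n * m) * f m"
      proof -
        have ac: "a * (g1 * g2 * g3) * f1 * f2 = a * g1 * (f1 * g2) * (f2 * g3)" for a g1 g2 g3 f1 f2 :: 'k
          by (simp add: mult_ac)
        show ?thesis by (rule trans[OF _ ac[symmetric]]) (simp only: N f mult_1_right)
      qed
      also have "\<dots> = f (n * m) * f m"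
        by (subst gauss_binom_fact) (simp_all add: f)
      finally have e: "f (Suc n * m) * gauss_binom v (Suc n * m) (n * m) = f (n * m) * f m" .
      have "f (Suc n * m) * (gauss_binom v (Suc n * m) (n * m) * (c ^ n) ^ m) = c ^ (n * m) * (f m * f (n * m))"
        unfolding mult.assoc[symmetric] e by (simp add: mult_ac flip: power_mult)
      then show ?thesis unfolding N by (simp add: power_mult)
    qed
    also have "\<dots> \<approx> sc (c ^ (n * m)) (sc (c ^ k) (sc (f m) (skew v e m c x) ^ n) * sc (f m) (skew v e m c x))"
      by (intro eqv_sc eqv_mult k eqv_refl)
    also have "\<dots> = sc (c ^ (n * m + k)) (sc (f m) (skew v e m c x) ^ Suc n)"
      unfolding power_Suc2 by (simp add: power_add mult_ac)
    finally show ?case by blast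
  next
    case (2 N)
    show ?case unfolding expand
    proof (intro I_sum t)
      fix a show "a > n * m \<or> N - a > m" using 2 by auto
    qed
  }
qed

text \<open>Solve \<open>skew_power\<close> for the n-th power, using the integral inverse
  \<open>d\<close> of \<open>c\<close>, and expand the other side in divided powers of
  \<open>e\<close>. The scalar \<open>y\<close> is left free so that it can be the inverse of a
  quantum factorial at another vertex j.\<close>

lemma skew_divided_power_integral:
  assumes f: "\<And>n. f n * gauss_fact v n = 1" and van: "skew v e (Suc m) c x \<in> I"
    and S: "v \<in> int_scalars" "c \<in> int_scalars" "d \<in> int_scalars" "c * d = 1"
    and e: "\<And>a. sc (f a) (e ^ a) \<in> B" and x: "sc y (x ^ n) \<in> B"
  shows "sc y (sc (f m) (skew v e m c x) ^ n) \<in> B"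
proof -
  obtain k where k: "sc (f (n * m)) (skew v e (n * m) (c ^ n) (x ^ n)) \<approx> sc (c ^ k) (sc (f m) (skew v e m c x) ^ n)"
    using skew_power(1)[OF f van] by blast
  have "sc y (sc (f m) (skew v e m c x) ^ n)
    = sc (d ^ k * y) (sc (c ^ k) (sc (f m) (skew v e m c x) ^ n))"
  proof -
    have "d ^ k * y * c ^ k = y * (c * d) ^ k" by (simp add: power_mult_distrib mult_ac)
    then show ?thesis by (simp add: S)
  qed
  also have "\<dots> \<approx> sc (d ^ k * y) (sc (f (n * m)) (skew v e (n * m) (c ^ n) (x ^ n)))"
    by (intro eqv_sc eqv_sym[OF k])
  also have "\<dots> = sc (d ^ k) (sc (f (n * m)) (skew v e (n * m) (c ^ n) (sc y (x ^ n))))"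
    by (simp add: skew_scale mult_ac)
  finally show ?thesis
    by (rule B_eqv)
       (unfold skew_divided_expand[OF f], intro B_sc B_sum B_mult int_scalars_intros S x e)
qed

end

text \<open>Compare the action of \<open>e\<close> and \<open>g\<close> on \<open>skew v e r c x\<close> with that of the Chevalley
  generators of \<open>sl\<^sub>2\<close> on a lowest weight vector: \<open>g\<close> takes it back to a multiple of
  \<open>skew v e (r - 1) c x\<close>.\<close>

locale lowest_weight = integral_form sc I B
  for sc :: "'k::comm_ring_1 \<Rightarrow> 'a::ring_1 \<Rightarrow> 'a" and I B +
  fixes v w c d q q' \<delta> :: 'k and e g L x :: 'a and m :: nat
  assumes vw: "v * w = 1" and cd: "c * d = 1" and qq: "q * q' = 1"
    and c_square: "c ^ 2 = w ^ m" and v_minus_1: "(v - 1) * \<delta> = q"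
    and eg: "e * g - sc w (g * e) \<approx> sc \<delta> (L - 1)"
    and Le: "L * e \<approx> sc (v ^ 2) (e * L)" and Lx: "L * x \<approx> sc (c ^ 2) (x * L)"
    and gx: "g * x \<approx> sc c (x * g)"
    and scalars: "v \<in> int_scalars" "w \<in> int_scalars" "c \<in> int_scalars" "d \<in> int_scalars"
       "q \<in> int_scalars" "q' \<in> int_scalars"
begin

text \<open>The analogue of the coefficient r (m - r + 1) with which the lowering operator acts on
  the r-th weight vector of the simple sl_2-module of dimension m + 1.\<close>

definition \<kappa> :: "nat \<Rightarrow> 'k" where
  "\<kappa> r = q * w ^ (m - r) * gauss_int v r * gauss_int v (Suc m - r)"

lemma vw_left: "v * (w * z) = z"
  by (simp add: vw flip: mult.assoc)

text \<open>The recursion that one lowering step produces, the second summand being its torus term.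
  It rests on (v - 1) ([r+1] [s+1] - [r] [s+2]) = v^(s+1) - v^r, where m = r + s + 1.\<close>

lemma \<kappa>_Suc:
  assumes "r < m"
  shows "\<kappa> (Suc r) = v * \<kappa> r + v * \<delta> * (1 - (v ^ r * c) ^ 2)"
proof -
  obtain s where m: "m = Suc (r + s)" using assms less_imp_Suc_add by blast
  let ?Z = "gauss_int v (Suc r) * gauss_int v (Suc s) - gauss_int v r * gauss_int v (Suc (Suc s))"
  have "?Z = v ^ r * gauss_int v (Suc s) - gauss_int v r * v ^ Suc s"
    by (simp add: gauss_int_Suc algebra_simps)
  then have "(v - 1) * ?Z = (v - 1) * (v ^ r * gauss_int v (Suc s) - gauss_int v r * v ^ Suc s)"
    by simp
  also have "\<dots> = v ^ r * ((v - 1) * gauss_int v (Suc s)) - ((v - 1) * gauss_int v r) * v ^ Suc s"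
    by (simp add: algebra_simps)
  also have "\<dots> = v ^ Suc s - v ^ r"
    unfolding gauss_int_mult by (simp add: algebra_simps)
  finally have Z: "(v - 1) * ?Z = v ^ Suc s - v ^ r" .
  have w: "v ^ n * w ^ n = 1" for n by (simp add: vw flip: power_mult_distrib)
  have "\<kappa> (Suc r) - v * \<kappa> r = q * w ^ s * gauss_int v (Suc r) * gauss_int v (Suc s)
      - q * (v * w) * w ^ s * gauss_int v r * gauss_int v (Suc (Suc s))"
    unfolding \<kappa>_def unfolding m by (simp add: mult_ac)
  also have "\<dots> = v * (w * w ^ s) * q * ?Z"
    by (simp add: algebra_simps vw_left)
  also have "\<dots> = v * \<delta> * (w ^ Suc s * ((v - 1) * ?Z))"
    unfolding v_minus_1[symmetric] by (simp add: mult_ac)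
  also have "w ^ Suc s * ((v - 1) * ?Z) = v ^ Suc s * w ^ Suc s - v ^ r * w ^ Suc s * (v ^ r * w ^ r)"
    unfolding Z unfolding right_diff_distrib w mult_1_right
    by (simp only: mult.commute[of "w ^ Suc s"] w)
  also have "\<dots> = 1 - (v ^ r * c) ^ 2"
  proof -
    have "v ^ r * w ^ Suc s * (v ^ r * w ^ r) = (v ^ r * c) ^ 2"
      unfolding power_mult_distrib c_square unfolding m power2_eq_square
      by (simp add: power_add mult_ac)
    then show ?thesis by (simp only: w)
  qed
  finally show ?thesis by (simp only: diff_eq_eq add.commute)
qed

text \<open>\<open>L\<close> is the torus element: every factor \<open>e\<close> contributes v^2 to
  the weight c^2 of \<open>x\<close>.\<close>

lemma L_skew: "L * skew v e r c x \<approx> sc ((v ^ r * c) ^ 2) (skew v e r c x * L)"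
proof (induction r)
  case (Suc r)
  let ?y = "skew v e r c x"
  have 1: "L * (e * ?y) \<approx> sc ((v ^ Suc r * c) ^ 2) (e * ?y * L)"
  proof -
    have "L * (e * ?y) = (L * e) * ?y" by (simp add: mult.assoc)
    also have "\<dots> \<approx> sc (v ^ 2) (e * L) * ?y" by (intro eqv_mult Le eqv_refl)
    also have "\<dots> = sc (v ^ 2) (e * (L * ?y))" by (simp add: mult.assoc)
    also have "\<dots> \<approx> sc (v ^ 2) (e * sc ((v ^ r * c) ^ 2) (?y * L))" by (intro eqv_sc eqv_mult Suc eqv_refl)
    also have "\<dots> = sc ((v ^ Suc r * c) ^ 2) (e * ?y * L)"
      by (simp add: mult.assoc power_mult_distrib)
    finally show ?thesis .
  qed
  have 2: "L * (?y * e) \<approx> sc ((v ^ Suc r * c) ^ 2) (?y * e * L)"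
  proof -
    have "L * (?y * e) = (L * ?y) * e" by (simp add: mult.assoc)
    also have "\<dots> \<approx> sc ((v ^ r * c) ^ 2) (?y * L) * e" by (intro eqv_mult Suc eqv_refl)
    also have "\<dots> = sc ((v ^ r * c) ^ 2) (?y * (L * e))" by (simp add: mult.assoc)
    also have "\<dots> \<approx> sc ((v ^ r * c) ^ 2) (?y * sc (v ^ 2) (e * L))" by (intro eqv_sc eqv_mult Le eqv_refl)
    also have "\<dots> = sc ((v ^ Suc r * c) ^ 2) (?y * e * L)"
      by (simp add: mult_ac power_mult_distrib)
    finally show ?thesis .
  qed
  have "L * skew v e (Suc r) c x = L * (e * ?y) - sc (v ^ r * c) (L * (?y * e))"
    by (simp add: algebra_simps)
  also have "\<dots> \<approx> sc ((v ^ Suc r * c) ^ 2) (e * ?y * L) - sc (v ^ r * c) (sc ((v ^ Suc r * c) ^ 2) (?y * e * L))"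
    by (intro eqv_diff eqv_sc 1 2)
  also have "\<dots> = sc ((v ^ Suc r * c) ^ 2) (skew v e (Suc r) c x * L)"
    by (simp add: left_diff_distrib scm.scale_right_diff_distrib mult.commute mult.assoc[where 'a='a])
  finally show ?case .
qed (simp add: Lx)

lemma ge: "g * e \<approx> sc v (e * g) - sc (v * \<delta>) (L - 1)"
proof -
  have "g * e = sc v (e * g) - sc v (e * g - sc w (g * e))"
    by (simp add: scm.scale_right_diff_distrib vw)
  also have "\<dots> \<approx> sc v (e * g) - sc v (sc \<delta> (L - 1))"
    by (intro eqv_diff eqv_refl eqv_sc eg)
  finally show ?thesis by simp
qed

text \<open>Moving \<open>g\<close> past the outer \<open>e\<close> leaves two contributions: the
  inner vector is lowered and raised again, which gives v times the previous coefficient, and L - 1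
  is evaluated by \<open>L_skew\<close>. \<open>\<kappa>_Suc\<close> adds them.\<close>

lemma g_skew:
  "r \<le> m \<Longrightarrow> g * skew v e r c x - sc (v ^ r * c) (skew v e r c x * g) \<approx> sc (\<kappa> r) (skew v e (r - 1) c x)"
proof (induction r)
  \<comment> \<open>The truncated index r - 1 is harmless here, since \<open>\<kappa> 0\<close> is
    0.\<close>
  case 0
  then show ?case using eqv_diff[OF gx eqv_refl, of "sc c (x * g)"] by (simp add: \<kappa>_def)
next
  case (Suc r)
  let ?y = "skew v e r c x" and ?c = "v ^ r * c"
  define z where "z = g * ?y - sc ?c (?y * g)"
  have z: "z \<approx> sc (\<kappa> r) (skew v e (r - 1) c x)" using Suc unfolding z_def by simp
  \<comment> \<open>The product g e left of \<open>?y\<close> and the product e g right of it are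
    reordered in opposite directions, so that \<open>g\<close> meets \<open>?y\<close> from both
    sides and \<open>z\<close> can be formed.\<close>
  have eq: "e * g = sc w (g * e) + (e * g - sc w (g * e))" by simp
  have "g * skew v e (Suc r) c x - sc (v ^ Suc r * c) (skew v e (Suc r) c x * g)
    = (g * e) * ?y - sc ?c (g * ?y * e) - sc (v * ?c) (e * ?y * g) + sc (v * ?c * ?c) (?y * (e * g))"
    by (simp add: algebra_simps scm.scale_right_diff_distrib)
  also have "\<dots> \<approx> (sc v (e * g) - sc (v * \<delta>) (L - 1)) * ?y - sc ?c (g * ?y * e) - sc (v * ?c) (e * ?y * g)
      + sc (v * ?c * ?c) (?y * (sc w (g * e) + sc \<delta> (L - 1)))"
    by (subst eq) (intro eqv_diff eqv_add eqv_sc eqv_mult ge eg eqv_refl)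
  also have "\<dots> = (sc v (e * z) - sc ?c (z * e)) - sc (v * \<delta>) (L * ?y - ?y)
     + sc (v * \<delta> * ?c ^ 2) (?y * L - ?y)"
  proof -
    have "v * ?c * ?c * w = ?c * ?c" by (simp add: mult_ac vw_left)
    then have "sc (v * ?c * ?c) (?y * (sc w (g * e))) = sc (?c * ?c) (?y * g * e)"
      by (simp add: mult.assoc[where 'a='a] del: power_Suc)
    then show ?thesis
      by (simp add: z_def distrib_left left_diff_distrib right_diff_distrib scm.scale_right_diff_distrib
          mult.assoc[where 'a='a] power2_eq_square algebra_simps)
  qed
  also have "\<dots> \<approx> sc v (e * sc (\<kappa> r) (skew v e (r - 1) c x)) - sc ?c (sc (\<kappa> r) (skew v e (r - 1) c x) * e)
     - sc (v * \<delta>) (sc (?c ^ 2) (?y * L) - ?y) + sc (v * \<delta> * ?c ^ 2) (?y * L - ?y)"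
    by (intro eqv_diff eqv_add eqv_sc eqv_mult z eqv_refl L_skew)
  also have "\<dots> = sc (v * \<kappa> r) ?y + sc (v * \<delta> * (1 - ?c ^ 2)) ?y"
  proof -
    have "sc v (e * sc (\<kappa> r) (skew v e (r - 1) c x)) - sc ?c (sc (\<kappa> r) (skew v e (r - 1) c x) * e)
      = sc (v * \<kappa> r) ?y"
      by (cases r) (simp_all add: \<kappa>_def scm.scale_right_diff_distrib mult_ac)
    moreover have "sc (v * \<delta> * ?c ^ 2) (?y * L - ?y) - sc (v * \<delta>) (sc (?c ^ 2) (?y * L) - ?y)
      = sc (v * \<delta> * (1 - ?c ^ 2)) ?y"
      by (simp add: scm.scale_right_diff_distrib right_diff_distrib scm.scale_left_diff_distrib)
    ultimately show ?thesis by (simp add: algebra_simps)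
  qed
  also have "\<dots> = sc (\<kappa> (Suc r)) ?y"
    using \<kappa>_Suc[of r] Suc by (simp add: sc_add_left)
  finally show ?case by simp
qed

text \<open>The twist starts at v^m c, and base \<open>w\<close> lowers it to v^(m-k) c after k
  steps, exactly the twist that \<open>g_skew\<close> has at level m - k.\<close>

lemma skew_skew:
  "k \<le> m \<Longrightarrow> skew w g k (v ^ m * c) (skew v e m c x) \<approx> sc (\<Prod>j<k. \<kappa> (m - j)) (skew v e (m - k) c x)"
proof (induction k)
  case (Suc k)
  let ?z = "skew w g k (v ^ m * c) (skew v e m c x)" and ?y = "skew v e (m - k) c x"
  have "v ^ m = v ^ k * v ^ (m - k)" using Suc by (simp flip: power_add)
  then have "w ^ k * (v ^ m * c) = (v * w) ^ k * (v ^ (m - k) * c)"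
    by (simp add: power_mult_distrib mult_ac)
  then have w: "w ^ k * (v ^ m * c) = v ^ (m - k) * c" by (simp add: vw)
  have "skew w g (Suc k) (v ^ m * c) (skew v e m c x) = g * ?z - sc (v ^ (m - k) * c) (?z * g)"
    by (simp add: w)
  also have "\<dots> \<approx> g * sc (\<Prod>j<k. \<kappa> (m - j)) ?y - sc (v ^ (m - k) * c) (sc (\<Prod>j<k. \<kappa> (m - j)) ?y * g)"
    using Suc by (intro eqv_diff eqv_mult eqv_sc eqv_refl) simp_all
  also have "\<dots> = sc (\<Prod>j<k. \<kappa> (m - j)) (g * ?y - sc (v ^ (m - k) * c) (?y * g))"
    by (simp add: scm.scale_right_diff_distrib mult_ac)
  also have "\<dots> \<approx> sc (\<Prod>j<k. \<kappa> (m - j)) (sc (\<kappa> (m - k)) (skew v e (m - k - 1) c x))"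
    by (intro eqv_sc g_skew) simp
  finally show ?case by simp
qed simp

text \<open>After m steps the chain is back at a multiple of \<open>x\<close> and the twist is again
  \<open>c\<close>, so \<open>gx\<close> kills the next commutator. This replaces the Serre relation
  when the Leibniz argument runs downwards.\<close>

lemma skew_skew_I: "skew w g (Suc m) (v ^ m * c) (skew v e m c x) \<in> I"
proof -
  let ?z = "skew w g m (v ^ m * c) (skew v e m c x)" and ?K = "\<Prod>j<m. \<kappa> (m - j)"
  have z: "?z \<approx> sc ?K x" using skew_skew[of m] by simp
  have "w ^ m * (v ^ m * c) = (v * w) ^ m * c"
    by (simp add: power_mult_distrib mult_ac)
  then have w: "w ^ m * (v ^ m * c) = c" by (simp add: vw)
  have "skew w g (Suc m) (v ^ m * c) (skew v e m c x) = g * ?z - sc c (?z * g)"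
    by (simp add: w)
  also have "\<dots> \<approx> g * sc ?K x - sc c (sc ?K x * g)"
    by (intro eqv_diff eqv_mult eqv_sc eqv_refl z)
  also have "\<dots> = sc ?K (g * x - sc c (x * g))"
    by (simp add: scm.scale_right_diff_distrib mult_ac)
  finally show ?thesis using gx by (auto simp: eqv_def intro: I_eqv I_sc)
qed

text \<open>Each of the two Gaussian factors runs through [1], ..., [m], one downwards and one
  upwards.\<close>

lemma prod_\<kappa>: "(\<Prod>j<m. \<kappa> (m - j)) = (\<Prod>j<m. q * w ^ j) * gauss_fact v m ^ 2"
proof -
  have up: "(\<Prod>j<n. gauss_int v (Suc j)) = gauss_fact v n" for n
    by (induction n) (simp_all add: mult.commute)
  have "(\<Prod>j<m. gauss_int v (m - j)) = (\<Prod>j<m. gauss_int v (Suc j))"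
    by (subst prod.nat_diff_reindex[symmetric]) (simp add: Suc_diff_Suc)
  then have down: "(\<Prod>j<m. gauss_int v (m - j)) = gauss_fact v m" by (simp add: up)
  have "(\<Prod>j<m. \<kappa> (m - j)) = (\<Prod>j<m. q * w ^ j * gauss_int v (m - j) * gauss_int v (Suc j))"
    by (rule prod.cong) (auto simp: \<kappa>_def Suc_diff_le)
  then show ?thesis by (simp add: prod.distrib up down power2_eq_square mult_ac)
qed

text \<open>Divided commutators with \<open>g\<close> lead from the divided highest vector back to
  \<open>x\<close>: the two inverse factorials cancel the square in \<open>prod_\<kappa>\<close> and
  leave a unit. So \<open>skew_divided_power_integral\<close>, applied to \<open>g\<close> in base
  \<open>w\<close>, returns the powers of \<open>x\<close>.\<close>

lemma power_integral_of_skew: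
  assumes f: "\<And>n. f n * gauss_fact v n = 1"
    and g: "\<And>a. sc (f a) (g ^ a) \<in> B"
    and Y: "sc y (sc (f m) (skew v e m c x) ^ n) \<in> B"
  shows "sc y (x ^ n) \<in> B"
proof -
  define u where "u a = v ^ (a choose 2)" for a
  define u' where "u' a = w ^ (a choose 2)" for a
  have uS: "u a \<in> int_scalars" "u' a \<in> int_scalars" for a
    unfolding u_def u'_def by (intro int_scalars_intros scalars)+
  have uu: "u a * u' a = 1" for a
    by (simp add: u_def u'_def vw flip: power_mult_distrib)
  \<comment> \<open>The inverse of the Gaussian factorial in base \<open>w\<close>, obtained from
    \<open>gauss_fact_inverse_base\<close>.\<close>
  define F where "F a = u a * f a" for a
  have F: "F a * gauss_fact w a = 1" for a
    using gauss_fact_inverse_base[OF vw, of a] f[of a] by (simp add: F_def u_def mult_ac)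
  have gF: "sc (F a) (g ^ a) \<in> B" for a
    using B_sc[OF uS(1) g, of a a] by (simp add: F_def)
  define Y where "Y = sc (f m) (skew v e m c x)"
  have I: "skew w g (Suc m) (v ^ m * c) Y \<in> I"
    unfolding Y_def skew_scale by (intro I_sc skew_skew_I)
  have C: "v ^ m * c \<in> int_scalars" "w ^ m * d \<in> int_scalars" "v ^ m * c * (w ^ m * d) = 1"
  proof -
    have "v ^ m * c * (w ^ m * d) = (v * w) ^ m * (c * d)"
      by (simp add: power_mult_distrib mult_ac)
    then show "v ^ m * c * (w ^ m * d) = 1" by (simp add: vw cd)
  qed (intro int_scalars_intros scalars)+
  \<comment> \<open>The unit that remains of the product of the \<open>\<kappa>\<close> once the
    factorials are cancelled; \<open>h'\<close> is its inverse.\<close>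
  define h where "h = (\<Prod>j<m. q * w ^ j)"
  define h' where "h' = (\<Prod>j<m. q' * v ^ j)"
  have hh: "h * h' = 1"
  proof -
    have "q * w ^ j * (q' * v ^ j) = (q * q') * (v * w) ^ j" for j
      by (simp add: power_mult_distrib mult_ac)
    then show ?thesis by (simp add: h_def h'_def qq vw flip: prod.distrib)
  qed
  have hS: "h' \<in> int_scalars" unfolding h'_def by (intro int_scalars_intros scalars)
  have "sc (F m) (skew w g m (v ^ m * c) Y)
    = sc (F m * f m) (skew w g m (v ^ m * c) (skew v e m c x))"
    by (simp add: Y_def skew_scale mult_ac)
  also have "\<dots> \<approx> sc (F m * f m) (sc (\<Prod>j<m. \<kappa> (m - j)) (skew v e (m - m) c x))"
    by (intro eqv_sc skew_skew) simp
  also have "\<dots> = sc (h * u m) x"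
  proof -
    have "F m * f m * (h * gauss_fact v m ^ 2) = h * u m * (f m * gauss_fact v m) ^ 2"
      by (simp add: F_def power2_eq_square mult_ac)
    then show ?thesis by (simp add: prod_\<kappa> f flip: h_def)
  qed
  finally have x: "sc (F m) (skew w g m (v ^ m * c) Y) ^ n \<approx> sc (h * u m) x ^ n"
    by (rule eqv_power)
  have "sc y (x ^ n) = sc ((h' * u' m) ^ n) (sc y (sc (h * u m) x ^ n))"
  proof -
    have "(h' * u' m) ^ n * (y * (h * u m) ^ n) = y * ((h * h') * (u m * u' m)) ^ n"
      by (simp add: power_mult_distrib mult_ac)
    then show ?thesis by (simp add: sc_power hh uu)
  qed
  also have "\<dots> \<approx> sc ((h' * u' m) ^ n) (sc y (sc (F m) (skew w g m (v ^ m * c) Y) ^ n))"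
    by (intro eqv_sc eqv_sym[OF x])
  finally have "sc y (x ^ n) \<approx> sc ((h' * u' m) ^ n) (sc y (sc (F m) (skew w g m (v ^ m * c) Y) ^ n))" .
  moreover have "sc y (sc (F m) (skew w g m (v ^ m * c) Y) ^ n) \<in> B"
    using assms(3) unfolding Y_def[symmetric]
    by (rule skew_divided_power_integral[OF F I scalars(2) C gF])
  then have "sc ((h' * u' m) ^ n) (sc y (sc (F m) (skew w g m (v ^ m * c) Y) ^ n)) \<in> B"
    by (intro B_sc[of "_ ^ _"] int_scalars_intros hS uS)
  ultimately show ?thesis by (rule B_eqv)
qed

end

section \<open>Scalars of the covering algebra\<close>

lemma inverse_qvar: "inverse qvar = QPi (Fract 1 [:0, 1:]) 0"
  by (simp add: inverse_qpi_def qvar_def power2_eq_square divide_fract_def eq_fract)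

lemma qvar_inverse: "qvar * inverse qvar = 1"
  by (simp add: inverse_qvar) (simp add: qvar_def times_qpi_def one_qpi_def One_fract_def eq_fract)

lemma inverse_pivar: "inverse pivar = pivar"
  by (simp add: inverse_qpi_def pivar_def)

lemma zero_laurent_int: "0 \<in> laurent_int"
  unfolding laurent_int_def Zero_fract_def
  by (rule CollectI, rule exI[of _ 0], rule exI[of _ 0]) (simp add: map_poly_0)

lemma scalarsA_generators: "qvar \<in> scalarsA" "inverse qvar \<in> scalarsA" "pivar \<in> scalarsA"
proof -
  have "Fract [:0, 1:] 1 = Fract (map_poly of_int [:0, 1:]) ([:0, 1:] ^ 0)"
    by (simp add: map_poly_pCons)
  then have "Fract [:0, 1:] 1 \<in> laurent_int" unfolding laurent_int_def by blast
  then show "qvar \<in> scalarsA" unfolding qvar_def scalarsA_def using zero_laurent_int by blast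
  have "Fract 1 [:0, 1:] = Fract (map_poly of_int 1) ([:0, 1:] ^ 1)"
    by simp
  then have "Fract 1 [:0, 1:] \<in> laurent_int" unfolding laurent_int_def by blast
  then show "inverse qvar \<in> scalarsA" unfolding inverse_qvar scalarsA_def using zero_laurent_int by blast
  have "1 = Fract (map_poly of_int 1) ([:0, 1:] ^ 0)"
    by (simp add: One_fract_def)
  then have "1 \<in> laurent_int" unfolding laurent_int_def by blast
  then show "pivar \<in> scalarsA" unfolding pivar_def scalarsA_def using zero_laurent_int by blast
qed

lemma unit_power_cancel:
  fixes a :: "'k::comm_ring_1"
  assumes "a * b = 1"
  shows "x = y + z \<Longrightarrow> a ^ x * b ^ y = a ^ z" "y = x + z \<Longrightarrow> a ^ x * b ^ y = b ^ z"
proof -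
  have ab: "a ^ n * (b ^ n * c) = c" for n c by (simp add: assms flip: power_mult_distrib mult.assoc)
  show "x = y + z \<Longrightarrow> a ^ x * b ^ y = a ^ z" using ab[of y "a ^ z"] by (simp add: power_add mult_ac)
  show "y = x + z \<Longrightarrow> a ^ x * b ^ y = b ^ z" using ab[of x "b ^ z"] by (simp add: power_add mult_ac)
qed

text \<open>Because (1 + \<pi>) (1 - \<pi>) = 0, the ring \<open>qpi\<close> is no domain;
  identifying inverses and cancelling both go through an explicit inverse.\<close>

lemma unit_inverse_unique:
  fixes a :: "'k::comm_ring_1"
  shows "a * b = 1 \<Longrightarrow> a * b' = 1 \<Longrightarrow> b = b'"
  by (metis mult.commute mult.left_commute mult.right_neutral)

lemma unit_cancel:
  fixes a :: "'k::comm_ring_1"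
  shows "a * b = 1 \<Longrightarrow> a * x = a * y \<Longrightarrow> x = y"
  by (metis mult.commute mult.left_commute mult.right_neutral)

lemma inverse_q_at: "inverse (q_at D i) = inverse qvar ^ symm D i"
  using unit_inverse_unique[OF qpi_inverse[OF q_at_unit], of D i "inverse qvar ^ symm D i"]
  by (simp add: q_at_def qvar_inverse flip: power_mult_distrib)

lemma q_at_inverse: "q_at D i * inverse (q_at D i) = 1"
  by (rule qpi_inverse[OF q_at_unit])

lemma pivar_power_even: "even n \<Longrightarrow> pivar ^ n = 1"
  by (auto simp: power_mult pivar_square elim!: evenE)

lemma pivar_power_cong: "even (a + b) \<Longrightarrow> pivar ^ a = pivar ^ b"
  by (metis even_add minus_one_power_iff pivar_square power_mult even_two_times_div_two odd_two_times_div_two_succ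
      power_Suc mult.right_neutral power_one Suc_eq_plus1)

lemma pivar_powi_even: "even n \<Longrightarrow> pivar powi n = 1"
  by (simp add: power_int_def inverse_pivar pivar_power_even even_nat_iff)

lemma pi_at_square: "pi_at D i ^ 2 = 1"
  by (simp add: pi_at_def pivar_power_even flip: power_mult)

text \<open>With v = \<pi>_i q_i^2 one has q_i^n ((\<pi>_i q_i)^n - q_i^(-n)) = v^n - 1, and the
  case n = 1 is the denominator. Hence q_i^(n-1) [n]_i is a Gaussian number, and the exponents add
  up to n choose 2.\<close>

lemma (in covering_datum) q_fact_gauss:
  "q_at D i ^ (n choose 2) * q_fact D i n = gauss_fact (pi_at D i * q_at D i ^ 2) n"
proof (induction n)
  case (Suc n)
  let ?P = "pi_at D i" and ?Q = "q_at D i" and ?R = "inverse (q_at D i)"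
  let ?v = "?P * ?Q ^ 2"
  have den: "q_den D i * inverse (q_den D i) = 1"
    by (rule qpi_inverse[OF q_den_unit[OF symm_pos]])
  have "?Q * q_den D i = ?P * ?Q ^ 2 - ?Q * ?R"
    by (simp add: q_den_def algebra_simps power2_eq_square)
  then have v: "?Q * q_den D i = ?v - 1" by (simp add: q_at_inverse)
  have "?Q ^ Suc n * ((?P * ?Q) ^ Suc n - ?R ^ Suc n) = ?v ^ Suc n - (?Q * ?R) ^ Suc n"
    by (simp add: power_mult_distrib algebra_simps power2_eq_square)
  also have "\<dots> = ?Q * q_den D i * gauss_int ?v (Suc n)"
    unfolding v gauss_int_mult by (simp add: q_at_inverse)
  finally have eq: "?Q ^ Suc n * ((?P * ?Q) ^ Suc n - ?R ^ Suc n) = ?Q * q_den D i * gauss_int ?v (Suc n)" .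
  have "?Q * (?Q ^ n * q_int D i (Suc n))
    = (?Q ^ Suc n * ((?P * ?Q) ^ Suc n - ?R ^ Suc n)) * inverse (q_den D i)"
    by (simp add: q_int_def divide_qpi_def mult_ac)
  also have "\<dots> = (q_den D i * inverse (q_den D i)) * (?Q * gauss_int ?v (Suc n))"
    unfolding eq by (simp only: mult_ac)
  finally have q: "?Q ^ n * q_int D i (Suc n) = gauss_int ?v (Suc n)"
    unfolding den mult_1_left by (rule unit_cancel[OF q_at_inverse])
  have "?Q ^ (Suc n choose 2) * q_fact D i (Suc n)
    = (?Q ^ n * q_int D i (Suc n)) * (?Q ^ (n choose 2) * q_fact D i n)"
    by (simp add: Suc_choose_two power_add q_fact_def mult_ac)
  then show ?case by (simp add: q Suc)
qed (simp add: q_fact_def)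

lemma (in covering_datum) q_fact_inverse: "q_fact D i n * (1 / q_fact D i n) = 1"
  using qpi_inverse[OF q_fact_unit[OF symm_pos]] by (simp add: divide_qpi_def)

section \<open>The free algebra as an algebra over \<open>qpi\<close>\<close>

definition sc_alg :: "qpi \<Rightarrow> 'g free_alg \<Rightarrow> 'g free_alg" where
  "sc_alg a x = scal a * x"

lemma scal_mult: "scal a * scal b = scal (a * b)"
  by (simp add: scal_def mult_single)

lemma scal_central: "x * scal a = scal a * x"
proof (induction x rule: update_induct)
  case (update f k b)
  have "Poly_Mapping.update k b f = Poly_Mapping.single k b + f"
    using update(1)
    by (intro poly_mapping_eqI) (auto simp: lookup_update lookup_add lookup_single in_keys_iff when_def)
  moreover have "Poly_Mapping.single k b * scal a = scal a * Poly_Mapping.single k b"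
    by (simp add: scal_def mult_single mult.commute)
  ultimately show ?case using update(3) by (simp add: algebra_simps)
qed simp

interpretation fa: scalar_algebra sc_alg
proof
  fix a b :: qpi and x y :: "'g free_alg"
  show "sc_alg (a + b) x = sc_alg a x + sc_alg b x"
    by (simp add: sc_alg_def scal_def single_add algebra_simps)
  show "sc_alg 1 x = x" by (simp add: sc_alg_def scal_def)
  show "x * sc_alg a y = sc_alg a (x * y)"
    by (simp add: sc_alg_def scal_central flip: mult.assoc)
qed (simp_all add: sc_alg_def algebra_simps scal_mult flip: mult.assoc)

lemma zmul_additive: "Modules.additive f \<Longrightarrow> f (zmul n x) = n * (f x :: int)"
  by (induction n rule: int_induct[where k = 0])
     (simp_all add: zmul_add1 zmul_minus1 additive.add additive.diff additive.zero algebra_simps)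

section \<open>Relations in the covering algebra\<close>

text \<open>\<open>B\<close> is left open because two choices occur: the preimage of the integral
  form and the preimage of its image under the braid automorphism at the fixed vertex
  \<open>i\<close>.\<close>

locale quantum_integral = covering_datum D + integral_form sc_alg "rel_ideal D" B
  for D :: "('i::finite, 'x::ab_group_add, 'y::ab_group_add) super_datum"
    and B :: "('i, 'y) falg set" +
  fixes i :: 'i
  assumes base_scalars: "qvar \<in> int_scalars" "inverse qvar \<in> int_scalars" "pivar \<in> int_scalars"
    and fJ_B: "fJ \<nu> \<in> B"
begin

notation eqv (infix "\<approx>" 50)

abbreviation "E \<equiv> fE :: 'i \<Rightarrow> ('i, 'y) falg"
abbreviation "F \<equiv> fF :: 'i \<Rightarrow> ('i, 'y) falg"
abbreviation "J \<equiv> fJt D i"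
abbreviation "K \<equiv> fKt D i"
abbreviation "K' \<equiv> fKt' D i"
abbreviation "sc \<equiv> sc_alg :: qpi \<Rightarrow> ('i, 'y) falg \<Rightarrow> ('i, 'y) falg"

definition "Q = q_at D i"
definition "Q' = inverse (q_at D i)"
definition "P = pi_at D i"
text \<open>The base of the Gaussian numbers at \<open>i\<close>. Its inverse is \<open>w\<close>,
  because \<pi>_i^2 = 1, and \<open>fact_inv\<close> inverts the Gaussian factorial rather than the
  balanced one.\<close>

definition "v = P * Q ^ 2"
definition "w = P * Q' ^ 2"
definition "fact_inv n = Q' ^ (n choose 2) * (1 / q_fact D i n)"

lemma QQ: "Q * Q' = 1" and PP: "P ^ 2 = 1" and vw: "v * w = 1"
proof -
  show QQ: "Q * Q' = 1" and PP: "P ^ 2 = 1"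
    by (simp_all add: Q_def Q'_def P_def q_at_inverse pi_at_square)
  have "v * w = P ^ 2 * (Q * Q') ^ 2" by (simp add: v_def w_def power2_eq_square mult_ac)
  then show "v * w = 1" by (simp add: QQ PP)
qed

lemma unit_scalars: "P \<in> int_scalars" "Q \<in> int_scalars" "Q' \<in> int_scalars"
    "v \<in> int_scalars" "w \<in> int_scalars" "pivar \<in> int_scalars"
  by (auto simp: v_def w_def P_def Q_def Q'_def q_at_def inverse_q_at[unfolded q_at_def] pi_at_def
      intro!: int_scalars_intros base_scalars)

lemma P_eq: "P = pivar ^ par D i"
  unfolding P_def pi_at_def
proof (rule pivar_power_cong)
  show "even (symm D i + par D i)" using symm_par[of i] by presburger
qed

text \<open>For odd i the Cartan entry is even, for even i the integer d_i is. Consequently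
  \<open>J\<close> commutes with all E_j and F_j.\<close>

lemma even_symm_cartan: "even (int (symm D i) * cartan D i j)"
proof (cases "i \<in> odd_part D")
  case False
  then have "even (symm D i)" using symm_par[of i] by (simp add: par_def even_iff_mod_2_eq_zero)
  then show ?thesis by simp
qed (simp add: cartan_odd)

lemma fact_inv: "fact_inv n * gauss_fact v n = 1"
proof -
  have "fact_inv n * gauss_fact v n
    = (Q ^ (n choose 2) * Q' ^ (n choose 2)) * (q_fact D i n * (1 / q_fact D i n))"
    unfolding v_def P_def Q_def q_fact_gauss[symmetric] by (simp add: fact_inv_def mult_ac)
  then show ?thesis unfolding q_fact_inverse by (simp add: QQ flip: power_mult_distrib)
qed

section \<open>The defining relations as congruences\<close>

lemma relator:
  assumes "x - y \<in> relators D"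
  shows "x \<approx> y"
proof -
  have "relators D \<subseteq> rel_ideal D"
    unfolding rel_ideal_def
    by (rule ring.genideal_self[OF ring_free_alg]) (simp add: free_alg_ring_def)
  then show ?thesis using assms by (auto simp: eqv_def)
qed

lemma KK: "fK \<mu> * fK \<nu> \<approx> fK (\<mu> + \<nu>)"
  and K_0: "fK 0 \<approx> 1" and J_0: "fJ 0 \<approx> 1" and J_sq: "fJ \<nu> ^ 2 \<approx> 1"
  and J_K: "fJ \<mu> * fK \<nu> \<approx> fK \<nu> * fJ \<mu>"
  by - (rule relator, simp only: relators_def Un_iff mem_Collect_eq insert_iff empty_iff, blast)+

lemma J_E: "fJ \<mu> * E j \<approx> sc (pivar powi pairing D \<mu> (root D j)) (E j * fJ \<mu>)"
  and J_F: "fJ \<mu> * F j \<approx> sc (pivar powi (- pairing D \<mu> (root D j))) (F j * fJ \<mu>)"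
  and K_E: "fK \<mu> * E j \<approx> sc (qvar powi pairing D \<mu> (root D j)) (E j * fK \<mu>)"
  and K_F: "fK \<mu> * F j \<approx> sc (qvar powi (- pairing D \<mu> (root D j))) (F j * fK \<mu>)"
  unfolding sc_alg_def mult.assoc[symmetric]
  by - (rule relator, simp only: relators_def Un_iff mem_Collect_eq insert_iff empty_iff, blast)+

lemma E_F: "j \<noteq> k \<Longrightarrow> E j * F k \<approx> sc (pivar ^ (par D j * par D k)) (F k * E j)"
proof -
  assume jk: "j \<noteq> k"
  have "E j * F k - scal (pivar ^ (par D j * par D k)) * F k * E j
        - (if j = k then scal (1 / q_den D j) * (fJt D j * fKt D j - fKt' D j) else 0) \<in> relators D"
    unfolding relators_def by blast
  then show ?thesis using jk by (intro relator) (simp add: sc_alg_def mult.assoc)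
qed

lemma E_F_same: "E i * F i - sc P (F i * E i) \<approx> sc (1 / q_den D i) (J * K - K')"
proof -
  have "E i * F i - scal (pivar ^ (par D i * par D i)) * F i * E i
        - (if i = i then scal (1 / q_den D i) * (J * K - K') else 0) \<in> relators D"
    unfolding relators_def by blast
  moreover have "pivar ^ (par D i * par D i) = P" unfolding P_eq by (simp add: par_def)
  ultimately show ?thesis by (intro relator) (simp add: sc_alg_def mult.assoc)
qed

lemma pairing_zmul: "pairing D (zmul n (coroot D i)) (root D j) = n * cartan D i j"
  and pairing_minus_zmul: "pairing D (- zmul n (coroot D i)) (root D j) = - (n * cartan D i j)"
proof -
  have a: "Modules.additive (\<lambda>\<mu>. pairing D \<mu> (root D j))"
    using pairing_perfect unfolding perfect_pairing_def by blast
  then show "pairing D (zmul n (coroot D i)) (root D j) = n * cartan D i j"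
    and "pairing D (- zmul n (coroot D i)) (root D j) = - (n * cartan D i j)"
    using zmul_additive[OF a, of n "coroot D i"] by (simp_all add: pairing_cartan additive.minus[OF a])
qed

lemma J_commutes: "J * E j \<approx> E j * J" "J * F j \<approx> F j * J" "J * fK \<mu> \<approx> fK \<mu> * J"
  using J_E[of "zmul (int (symm D i)) (coroot D i)" j] J_F[of "zmul (int (symm D i)) (coroot D i)" j]
    J_K[of "zmul (int (symm D i)) (coroot D i)" \<mu>]
  by (simp_all add: fJt_def pairing_zmul pivar_powi_even[OF even_symm_cartan] pivar_powi_even[OF even_symm_cartan[THEN even_minus[THEN iffD2]]])

lemma K_minus: "fK \<mu> * fK (- \<mu>) \<approx> 1" "fK (- \<mu>) * fK \<mu> \<approx> 1"
  using eqv_trans[OF KK, of \<mu> "- \<mu>" 1] eqv_trans[OF KK, of "- \<mu>" \<mu> 1] K_0 by simp_all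

lemma J_square: "J ^ 2 \<approx> 1" and K_K': "K * K' \<approx> 1" and K'_K: "K' * K \<approx> 1"
  by (simp_all add: fJt_def fKt_def fKt'_def J_sq K_minus)

lemma qvar_powi: "qvar powi (int (symm D i) * int n) = Q ^ n" "qvar powi (- (int (symm D i) * int n)) = Q' ^ n"
proof -
  show 1: "qvar powi (int (symm D i) * int n) = Q ^ n"
    unfolding of_nat_mult[symmetric] power_int_of_nat by (simp add: Q_def q_at_def power_mult)
  show "qvar powi (- (int (symm D i) * int n)) = Q' ^ n"
  \<comment> \<open>\<open>power_int\<close> branches on the sign of the exponent, so exponent zero,
    which negation leaves nonnegative, is treated separately.\<close>
  proof (cases "symm D i * n = 0")
    case True
    then show ?thesis using symm_pos[of i] by auto
  next
    case False
    then have "\<not> (0 \<le> - (int (symm D i) * int n))" by (simp add: not_le)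
    moreover have "nat (- (- (int (symm D i) * int n))) = symm D i * n" by (simp add: nat_mult_distrib)
    ultimately show ?thesis
      by (simp only: power_int_def if_False Q'_def inverse_q_at power_mult)
  qed
qed

lemma K_weights:
  "K * E i \<approx> sc (Q ^ 2) (E i * K)" "K * F i \<approx> sc (Q' ^ 2) (F i * K)"
  "K' * E i \<approx> sc (Q' ^ 2) (E i * K')" "K' * F i \<approx> sc (Q ^ 2) (F i * K')"
  using K_E[of "zmul (int (symm D i)) (coroot D i)" i] K_F[of "zmul (int (symm D i)) (coroot D i)" i]
    K_E[of "- zmul (int (symm D i)) (coroot D i)" i] K_F[of "- zmul (int (symm D i)) (coroot D i)" i]
    qvar_powi[of 2]
  by (simp_all add: fKt_def fKt'_def pairing_zmul pairing_minus_zmul cartan_diag)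

section \<open>Twists and weights for j \<noteq> i\<close>

definition deg :: "'i \<Rightarrow> nat" where "deg j = nat (- cartan D i j)"
text \<open>For j \<noteq> i this is \<pi>^(p(i) p(j)) q_i^(a_ij), the twist that makes the Serre
  relation an iterated skew commutator; see \<open>serre_skew\<close>.\<close>

definition twist :: "'i \<Rightarrow> qpi" where "twist j = pivar ^ (par D i * par D j) * Q' ^ deg j"
definition twist' :: "'i \<Rightarrow> qpi" where "twist' j = pivar ^ (par D i * par D j) * Q ^ deg j"

text \<open>The last vector of the string before the Serre relation kills it, divided by the
  Gaussian factorial.\<close>

definition highest :: "('i \<Rightarrow> ('i, 'y) falg) \<Rightarrow> 'i \<Rightarrow> ('i, 'y) falg" where
  "highest X j = sc (fact_inv (deg j)) (fa.skew v (X i) (deg j) (twist j) (X j))"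

lemma cartan_deg: "i \<noteq> j \<Longrightarrow> cartan D i j = - int (deg j)"
  using cartan_offdiag[of i j] by (simp add: deg_def)

lemma twist_twist': "twist j * twist' j = 1"
proof -
  have "twist j * twist' j = (pivar ^ 2) ^ (par D i * par D j) * (Q * Q') ^ deg j"
    by (simp add: twist_def twist'_def power2_eq_square power_mult_distrib mult_ac)
  then show ?thesis by (simp add: pivar_square QQ)
qed

lemma twist_scalars: "twist j \<in> int_scalars" "twist' j \<in> int_scalars"
  unfolding twist_def twist'_def by (intro int_scalars_intros unit_scalars)+

text \<open>For odd i the degree is even, and for even i already \<pi>_i = 1. This removes \<pi>_i
  from w^m, so that the square of the twist can equal w^m.\<close>

lemma P_power_deg: "i \<noteq> j \<Longrightarrow> P ^ deg j = 1"
proof (cases "i \<in> odd_part D")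
  case True
  assume "i \<noteq> j"
  then have "even (deg j)" using cartan_odd[OF True, of j] by (simp add: cartan_deg)
  then show ?thesis by (simp add: P_eq pivar_power_even flip: power_mult)
qed (simp add: P_eq par_def)

lemma twist_square: "i \<noteq> j \<Longrightarrow> twist j ^ 2 = w ^ deg j" "twist j ^ 2 = Q' ^ deg j * Q' ^ deg j"
proof -
  show 1: "twist j ^ 2 = Q' ^ deg j * Q' ^ deg j"
  proof -
    have "twist j ^ 2 = (pivar ^ 2) ^ (par D i * par D j) * (Q' ^ deg j * Q' ^ deg j)"
      by (simp add: twist_def power2_eq_square power_mult_distrib mult_ac)
    then show ?thesis by (simp add: pivar_square)
  qed
  show "twist j ^ 2 = w ^ deg j" if "i \<noteq> j"
    unfolding 1 by (simp add: w_def power_mult_distrib P_power_deg[OF that] power2_eq_square)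
qed

lemma v_minus_one: "(v - 1) * (1 / q_den D i) = Q"
proof -
  have "v - 1 = Q * q_den D i"
    using QQ by (simp add: v_def q_den_def P_def Q_def Q'_def algebra_simps power2_eq_square)
  then show ?thesis
    using qpi_inverse[OF q_den_unit[OF symm_pos], of i] by (simp add: divide_qpi_def mult.assoc)
qed

lemma v_square: "v ^ 2 = Q ^ 2 * Q ^ 2" and w_Q: "w * Q ^ 2 = P" and w_P_Q: "P * (w * Q ^ 2) = 1"
proof -
  have "v ^ 2 = P ^ 2 * (Q ^ 2 * Q ^ 2)" by (simp add: v_def power2_eq_square mult_ac)
  then show "v ^ 2 = Q ^ 2 * Q ^ 2" by (simp add: PP)
  have "w * Q ^ 2 = P * (Q * Q') ^ 2" by (simp add: w_def power_mult_distrib mult_ac)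
  then show "w * Q ^ 2 = P" by (simp add: QQ)
  then show "P * (w * Q ^ 2) = 1" using PP by (simp add: power2_eq_square)
qed

lemma K_weights_off_diagonal:
  assumes "i \<noteq> j"
  shows "K * E j \<approx> sc (Q' ^ deg j) (E j * K)" "K' * F j \<approx> sc (Q' ^ deg j) (F j * K')"
  using K_E[of "zmul (int (symm D i)) (coroot D i)" j] K_F[of "- zmul (int (symm D i)) (coroot D i)" j]
    qvar_powi[of "deg j"]
  by (simp_all add: fKt_def fKt'_def pairing_zmul pairing_minus_zmul cartan_deg[OF assms])

lemma J_commutes': "J * E j \<approx> sc 1 (E j * J)" "J * F j \<approx> sc 1 (F j * J)"
  by (simp_all add: J_commutes)

lemma F_E: "i \<noteq> j \<Longrightarrow> F i * E j \<approx> sc (pivar ^ (par D i * par D j)) (E j * F i)"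
proof -
  let ?a = "pivar ^ (par D i * par D j)"
  assume "i \<noteq> j"
  then have "E j * F i \<approx> sc ?a (F i * E j)" using E_F[of j i] by (simp add: mult.commute)
  from eqv_sym[OF eqv_sc[OF this, of ?a]]
  show ?thesis by (simp add: pivar_power_even flip: power_add)
qed

text \<open>The partners of \<open>E\<^sub>i\<close> and \<open>F\<^sub>i\<close> chosen here are, up to units, the images under the
  braid automorphism of \<open>J E\<^sub>i\<close> and \<open>J F\<^sub>i\<close>; this is what makes the descent formula integral
  for the image of the integral form.\<close>

lemma lowest_weight_E:
  assumes ij: "i \<noteq> j"
  shows "lowest_weight sc (rel_ideal D) B v w (twist j) (twist' j) Q Q' (1 / q_den D i)
    (E i) (F i * K) (J * K * K) (E j) (deg j)"
proof
  let ?\<delta> = "1 / q_den D i"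
  have FKE: "F i * K * E i \<approx> sc (Q ^ 2) (F i * E i * K)"
  proof -
    have "F i * K * E i = F i * (K * E i)" by (simp add: mult.assoc)
    also have "\<dots> \<approx> F i * sc (Q ^ 2) (E i * K)" by (intro eqv_mult eqv_refl K_weights)
    finally show ?thesis by (simp add: mult.assoc)
  qed
  have "E i * (F i * K) - sc w (F i * K * E i) \<approx> E i * (F i * K) - sc w (sc (Q ^ 2) (F i * E i * K))"
    by (intro eqv_diff eqv_sc eqv_refl FKE)
  \<comment> \<open>Since w q_i^2 = \<pi>_i, pulling \<open>K\<close> to the right turns the
    commutator with base \<open>w\<close> into the supercommutator of the defining relation.\<close>
  also have "\<dots> = (E i * F i - sc P (F i * E i)) * K"
    by (simp add: w_Q algebra_simps)
  also have "\<dots> \<approx> sc ?\<delta> (J * K - K') * K"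
    by (intro eqv_mult eqv_refl E_F_same)
  also have "\<dots> = sc ?\<delta> (J * K * K - K' * K)" by (simp add: algebra_simps)
  also have "\<dots> \<approx> sc ?\<delta> (J * K * K - 1)"
    by (intro eqv_sc eqv_diff eqv_refl K'_K)
  finally show "E i * (F i * K) - sc w (F i * K * E i) \<approx> sc ?\<delta> (J * K * K - 1)" .
  show "J * K * K * E i \<approx> sc (v ^ 2) (E i * (J * K * K))"
    using commute_mult[OF commute_mult[OF J_commutes'(1) K_weights(1)] K_weights(1)]
    by (simp add: v_square)
  show "J * K * K * E j \<approx> sc (twist j ^ 2) (E j * (J * K * K))"
    using commute_mult[OF commute_mult[OF J_commutes'(1) K_weights_off_diagonal(1)[OF ij]]
        K_weights_off_diagonal(1)[OF ij]]
    by (simp add: twist_square(2))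
  show "F i * K * E j \<approx> sc (twist j) (E j * (F i * K))"
    using commute_mult[OF F_E[OF ij] K_weights_off_diagonal(1)[OF ij]] by (simp add: twist_def)
qed (use vw twist_twist' QQ twist_square(1)[OF ij] v_minus_one unit_scalars twist_scalars in simp_all)

lemma lowest_weight_F:
  assumes ij: "i \<noteq> j"
  shows "lowest_weight sc (rel_ideal D) B v w (twist j) (twist' j) Q Q' (1 / q_den D i)
    (F i) (sc P (J * E i * K')) (J * K' * K') (F j) (deg j)"
proof
  let ?\<delta> = "1 / q_den D i"
  have 1: "F i * (J * E i * K') \<approx> J * (F i * E i) * K'"
  proof -
    have "F i * (J * E i * K') = (F i * J) * (E i * K')" by (simp add: mult.assoc)
    also have "\<dots> \<approx> (J * F i) * (E i * K')" by (intro eqv_mult eqv_refl eqv_sym[OF J_commutes(2)])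
    finally show ?thesis by (simp add: mult.assoc)
  qed
  have 2: "J * E i * K' * F i \<approx> sc (Q ^ 2) (J * (E i * F i) * K')"
  proof -
    have "J * E i * K' * F i = J * E i * (K' * F i)" by (simp add: mult.assoc)
    also have "\<dots> \<approx> J * E i * sc (Q ^ 2) (F i * K')" by (intro eqv_mult eqv_refl K_weights)
    finally show ?thesis by (simp add: mult.assoc)
  qed
  have "F i * sc P (J * E i * K') - sc w (sc P (J * E i * K') * F i)
    = sc P (F i * (J * E i * K')) - sc (w * P) (J * E i * K' * F i)" by simp
  also have "\<dots> \<approx> sc P (J * (F i * E i) * K') - sc (w * P) (sc (Q ^ 2) (J * (E i * F i) * K'))"
    by (intro eqv_diff eqv_sc 1 2)
  \<comment> \<open>The factor \<open>P\<close> in the partner makes the second coefficient 1, so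
    the supercommutator appears with a minus sign. The sign and the factor \<open>J\<close> then
    turn J K - K' into J K'^2 - 1.\<close>
  also have "\<dots> = 0 - J * (E i * F i - sc P (F i * E i)) * K'"
    by (simp add: w_P_Q algebra_simps)
  also have "\<dots> \<approx> 0 - J * sc ?\<delta> (J * K - K') * K'"
    by (intro eqv_diff eqv_mult eqv_refl E_F_same)
  also have "\<dots> = sc ?\<delta> (J * K' * K' - J ^ 2 * (K * K'))"
    by (simp add: algebra_simps power2_eq_square)
  also have "\<dots> \<approx> sc ?\<delta> (J * K' * K' - 1 * 1)"
    by (intro eqv_sc eqv_diff eqv_mult eqv_refl J_square K_K')
  finally show "F i * sc P (J * E i * K') - sc w (sc P (J * E i * K') * F i) \<approx> sc ?\<delta> (J * K' * K' - 1)"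
    by simp
  show "J * K' * K' * F i \<approx> sc (v ^ 2) (F i * (J * K' * K'))"
    using commute_mult[OF commute_mult[OF J_commutes'(2) K_weights(4)] K_weights(4)]
    by (simp add: v_square)
  show "J * K' * K' * F j \<approx> sc (twist j ^ 2) (F j * (J * K' * K'))"
    using commute_mult[OF commute_mult[OF J_commutes'(2) K_weights_off_diagonal(2)[OF ij]]
        K_weights_off_diagonal(2)[OF ij]]
    by (simp add: twist_square(2))
  show "sc P (J * E i * K') * F j \<approx> sc (twist j) (F j * sc P (J * E i * K'))"
    using eqv_sc[OF commute_mult[OF commute_mult[OF J_commutes'(2) E_F[OF ij]] K_weights_off_diagonal(2)[OF ij]], of P]
    by (simp add: twist_def mult_ac)
qed (use vw twist_twist' QQ twist_square(1)[OF ij] v_minus_one unit_scalars twist_scalars in simp_all)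

section \<open>Serre relations and the braid formulas\<close>

text \<open>The powers of q_i from the three factorials combine to (n choose 2) - (k choose 2) -
  (n-k choose 2) = k (n - k).\<close>

lemma gauss_binom_q_binom:
  assumes "k \<le> n"
  shows "gauss_binom v n k = Q ^ (k * (n - k)) * q_binom D i n k"
proof -
  let ?q = "q_fact D i"
  \<comment> \<open>Inversion in \<open>qpi\<close> is meaningful on units only, so the inverse of
    the product in \<open>q_binom\<close> is identified by uniqueness.\<close>
  have "(?q k * ?q (n - k)) * (1 / ?q k * (1 / ?q (n - k))) = (?q k * (1 / ?q k)) * (?q (n - k) * (1 / ?q (n - k)))"
    by (simp only: mult_ac)
  then have "(?q k * ?q (n - k)) * (1 / ?q k * (1 / ?q (n - k))) = 1" by (simp only: q_fact_inverse mult_1_left)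
  moreover have "(?q k * ?q (n - k)) * inverse (?q k * ?q (n - k)) = 1"
    by (rule qpi_inverse) (use calculation in \<open>metis dvd_triv_left\<close>)
  ultimately have inv: "inverse (?q k * ?q (n - k)) = 1 / ?q k * (1 / ?q (n - k))"
    by (rule unit_inverse_unique[symmetric])
  have Q: "Q ^ (n choose 2) * Q' ^ ((k choose 2) + (n - k choose 2)) = Q ^ (k * (n - k))"
    using choose_two_add[of k "n - k"] assms by (intro unit_power_cancel QQ) simp
  have "gauss_binom v n k = gauss_binom v n k * (fact_inv k * gauss_fact v k) * (fact_inv (n - k) * gauss_fact v (n - k))"
    by (simp add: fact_inv)
  also have "\<dots> = (gauss_binom v n k * gauss_fact v k * gauss_fact v (n - k)) * fact_inv k * fact_inv (n - k)"
    by (simp only: mult_ac)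
  also have "\<dots> = (Q ^ (n choose 2) * ?q n) * fact_inv k * fact_inv (n - k)"
    unfolding gauss_binom_fact[OF assms] by (simp add: v_def P_def Q_def q_fact_gauss)
  also have "\<dots> = (Q ^ (n choose 2) * Q' ^ ((k choose 2) + (n - k choose 2))) * (?q n * (1 / ?q k * (1 / ?q (n - k))))"
    unfolding fact_inv_def by (simp only: power_add mult_ac)
  also have "\<dots> = Q ^ (k * (n - k)) * q_binom D i n k"
    unfolding Q inv[symmetric] by (simp add: q_binom_def divide_qpi_def)
  finally show ?thesis .
qed

text \<open>With m = \<open>deg j\<close>, the powers of q_i from the binomial and from v^(k choose
  2) multiply to q_i^(m k) and cancel against the k-th power of the twist. Only the powers of \<pi>
  in the Serre relation remain.\<close>

lemma serre_skew:
  assumes "i \<noteq> j"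
  shows "serre D X i j = fa.skew v (X i) (Suc (deg j)) (twist j) (X j)"
proof -
  have b: "nat (1 - cartan D i j) = Suc (deg j)" by (simp add: cartan_deg[OF assms])
  have "(- 1) ^ k * pivar ^ ((k choose 2) * par D i + k * par D i * par D j) * q_binom D i (Suc (deg j)) k
    = (- 1) ^ k * v ^ (k choose 2) * twist j ^ k * gauss_binom v (Suc (deg j)) k"
    if k: "k \<le> Suc (deg j)" for k
  proof -
    have e: "2 * (k choose 2) + k * (Suc (deg j) - k) = deg j * k + 0"
    proof -
      obtain l where l: "Suc (deg j) = k + l" using k le_Suc_ex by blast
      have "2 * (k choose 2) + k * l + k = (deg j * k) + k"
        using two_times_choose_two[of k] l by (metis add.assoc add.commute add_mult_distrib2 mult.commute mult_Suc_right)
      then show ?thesis by (simp add: l)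
    qed
    have "v ^ (k choose 2) * twist j ^ k * gauss_binom v (Suc (deg j)) k
      = P ^ (k choose 2) * pivar ^ (k * par D i * par D j)
        * (Q ^ (2 * (k choose 2) + k * (Suc (deg j) - k)) * Q' ^ (deg j * k)) * q_binom D i (Suc (deg j)) k"
      unfolding gauss_binom_q_binom[OF k] unfolding v_def twist_def
      by (simp only: power_mult_distrib power_add power_mult[symmetric] mult_ac)
    also have "\<dots> = pivar ^ ((k choose 2) * par D i + k * par D i * par D j) * q_binom D i (Suc (deg j)) k"
      unfolding unit_power_cancel(1)[OF QQ e] P_eq
      by (simp add: power_add mult_ac flip: power_mult)
    finally show ?thesis by (simp add: mult.assoc)
  qed
  then show ?thesis
    unfolding serre_def Let_def b fa.skew_expand atLeast0AtMost sc_alg_def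
    by (intro sum.cong) (auto simp: mult.assoc)
qed

lemma skew_serre_I:
  assumes "i \<noteq> j"
  shows "fa.skew v (E i) (Suc (deg j)) (twist j) (E j) \<in> rel_ideal D"
    "fa.skew v (F i) (Suc (deg j)) (twist j) (F j) \<in> rel_ideal D"
proof -
  have "serre D E i j - 0 \<in> relators D" "serre D F i j - 0 \<in> relators D"
    unfolding relators_def using assms by (simp_all, blast+)
  from this[THEN relator] show "fa.skew v (E i) (Suc (deg j)) (twist j) (E j) \<in> rel_ideal D"
    "fa.skew v (F i) (Suc (deg j)) (twist j) (F j) \<in> rel_ideal D"
    unfolding serre_skew[OF assms] by (simp_all only: eqv_def diff_0_right)
qed

text \<open>In the formula for F_j the index r counts the factors on the right, as in
  \<open>highest_expand\<close>; in that for E_j it counts those on the left, so that sum is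
  enumerated backwards.\<close>

lemma sum_pairs:
  assumes "i \<noteq> j"
  shows "(\<Sum>(r, s) \<in> {(r, s). int r + int s = - cartan D i j}. h r s) = (\<Sum>r\<le>deg j. h r (deg j - r))"
    "(\<Sum>(r, s) \<in> {(r, s). int r + int s = - cartan D i j}. h r s) = (\<Sum>r\<le>deg j. h (deg j - r) r)"
proof -
  let ?A = "{(r, s). int r + int s = - cartan D i j}"
  have 1: "?A = (\<lambda>r. (r, deg j - r)) ` {..deg j}" and 2: "?A = (\<lambda>r. (deg j - r, r)) ` {..deg j}"
    unfolding cartan_deg[OF assms] by (auto simp: image_iff)
  show "(\<Sum>(r, s) \<in> ?A. h r s) = (\<Sum>r\<le>deg j. h r (deg j - r))"
    unfolding 1 by (subst sum.reindex) (auto simp: inj_on_def)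
  show "(\<Sum>(r, s) \<in> ?A. h r s) = (\<Sum>r\<le>deg j. h (deg j - r) r)"
    unfolding 2 by (subst sum.reindex) (auto simp: inj_on_def)
qed

section \<open>The braid formulas as highest vectors\<close>

lemma highest_expand:
  "highest X j = (\<Sum>r\<le>deg j. sc ((- 1) ^ r * v ^ (r choose 2) * twist j ^ r * Q' ^ ((deg j - r choose 2) + (r choose 2)))
     (sc (1 / q_fact D i (deg j - r)) (X i ^ (deg j - r)) * X j * sc (1 / q_fact D i r) (X i ^ r)))"
  unfolding highest_def skew_divided_expand[OF fact_inv]
  by (intro sum.cong refl) (simp add: fact_inv_def power_add mult_ac)

lemma fE_div_eq: "fE_div D j n = sc (1 / q_fact D j n) (E j ^ n)"
  and fF_div_eq: "fF_div D j n = sc (1 / q_fact D j n) (F j ^ n)"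
  by (simp_all add: fE_div_def fF_div_def sc_alg_def)

text \<open>The balance of q_i-exponents behind both braid formulas; it comes from m r = r^2 + r
  s.\<close>

lemma highest_exponent:
  assumes "r + s = m"
  shows "m * r + ((s choose 2) + (r choose 2)) = ((m choose 2) + 2 * (r choose 2)) + r"
  using choose_two_add[of r s] two_times_choose_two[of r] unfolding assms[symmetric]
  by (simp add: algebra_simps)

text \<open>Both sides carry the same products of divided powers. With m = \<open>deg j\<close>, the
  factor q_i^(m choose 2) reduces the power of q_i in the r-th coefficient to q_i^(-r).\<close>

lemma braid_F_highest:
  assumes "i \<noteq> j"
  shows "braid_F D i j = sc (Q ^ (deg j choose 2)) (J ^ par D j * highest F j)"
proof -
  have "Q ^ (deg j choose 2) * ((- 1) ^ r * v ^ (r choose 2) * twist j ^ r * Q' ^ ((deg j - r choose 2) + (r choose 2)))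
    = (- 1) ^ r * pi_at D i ^ (r * par D i * par D j + (r choose 2) * par D i) * inverse (q_at D i) ^ r"
    if r: "r \<le> deg j" for r
  proof -
    have e: "deg j * r + ((deg j - r choose 2) + (r choose 2)) = ((deg j choose 2) + 2 * (r choose 2)) + r"
      using r by (intro highest_exponent) simp
    have "Q ^ (deg j choose 2) * ((- 1) ^ r * v ^ (r choose 2) * twist j ^ r * Q' ^ ((deg j - r choose 2) + (r choose 2)))
      = (- 1) ^ r * (P ^ (r choose 2) * pivar ^ (r * par D i * par D j))
        * (Q ^ ((deg j choose 2) + 2 * (r choose 2)) * Q' ^ (deg j * r + ((deg j - r choose 2) + (r choose 2))))"
      unfolding v_def twist_def by (simp only: power_mult_distrib power_add power_mult[symmetric] mult_ac)
    also have "Q ^ ((deg j choose 2) + 2 * (r choose 2)) * Q' ^ (deg j * r + ((deg j - r choose 2) + (r choose 2))) = Q' ^ r"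
      by (rule unit_power_cancel(2)[OF QQ e])
    \<comment> \<open>For even i both sides are 1; for odd i one has \<pi>_i = \<pi>.\<close>
    also have "P ^ (r choose 2) * pivar ^ (r * par D i * par D j)
      = P ^ (r * par D i * par D j + (r choose 2) * par D i)"
      unfolding P_eq by (cases "par D i = 0") (simp_all add: par_def power_add mult.commute split: if_splits)
    finally show ?thesis by (simp only: P_def Q'_def)
  qed
  then have "(\<Sum>(r, s) \<in> {(r, s). int r + int s = - cartan D i j}.
        scal ((- 1) ^ r * pi_at D i ^ (r * par D i * par D j + (r choose 2) * par D i)
              * inverse (q_at D i) ^ r)
        * fF_div D i s * fF j * fF_div D i r) = sc (Q ^ (deg j choose 2)) (highest F j)"
    unfolding sum_pairs(1)[OF assms] highest_expand fa.scm.scale_sum_right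
    by (intro sum.cong refl)
      (simp add: fF_div_eq[symmetric] sc_alg_def[symmetric] mult.assoc)
  then show ?thesis unfolding braid_F_def by simp
qed

text \<open>Later uses ask only for a unit with integral inverse, so the scalar stays existential.
  Reversing the sum turns (-1)^r into (-1)^(m-r), which together with the exponents of q_i dictates
  the witness \<open>u\<close>.\<close>

lemma braid_E_highest:
  assumes "i \<noteq> j"
  shows "\<exists>u u'. u * u' = 1 \<and> u \<in> int_scalars \<and> u' \<in> int_scalars
    \<and> braid_E D i j = sc u (J ^ par D j * highest E j)"
proof -
  define p where "p = pi_at D i powi int_choose2 (cartan D i j)"
  define u where "u = (- 1) ^ deg j * P ^ (deg j choose 2) * Q ^ ((deg j choose 2) + deg j)"
  define u' where "u' = (- 1) ^ deg j * P ^ (deg j choose 2) * Q' ^ ((deg j choose 2) + deg j)"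
  have "P * inverse P = 1"
    using PP by (intro qpi_inverse dvdI[of _ _ P]) (simp add: power2_eq_square)
  then have "inverse P = P" using PP unit_inverse_unique[of P "inverse P" P] by (simp add: power2_eq_square)
  \<comment> \<open>The exponent in \<open>p\<close> is an integer, but \<pi>_i is its own inverse,
    so a natural exponent suffices.\<close>
  then have "\<exists>n. p = P ^ n"
    unfolding p_def P_def[symmetric] power_int_def by simp blast
  then obtain n where p: "p = P ^ n" by blast
  have sq: "P ^ n * P ^ n = 1" for n
    using PP by (simp add: power2_eq_square flip: power_mult_distrib)
  have "u * u' = ((- 1) ^ deg j * (- 1) ^ deg j) * (P ^ (deg j choose 2) * P ^ (deg j choose 2)) * (Q * Q') ^ ((deg j choose 2) + deg j)"
    unfolding u_def u'_def by (simp only: power_mult_distrib mult_ac)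
  then have uu: "u * u' = 1" unfolding sq QQ by (simp flip: power_mult_distrib)
  have "p * u * (p * u') = (p * p) * (u * u')" by (simp only: mult_ac)
  then have puu: "p * u * (p * u') = 1" by (simp add: uu p sq)
  have S: "p * u \<in> int_scalars" "p * u' \<in> int_scalars"
    unfolding p u_def u'_def by (intro int_scalars_intros unit_scalars)+
  have coeff: "u * ((- 1) ^ r * v ^ (r choose 2) * twist j ^ r * Q' ^ ((deg j - r choose 2) + (r choose 2)))
    = (- 1) ^ s * pi_at D i ^ (s * par D i * par D j + (s choose 2) * par D i) * (pi_at D i * q_at D i) ^ s"
    if r: "r \<le> deg j" and s: "s = deg j - r" for r s
  proof -
    have rs: "deg j = r + s" using r s by simp
    have e: "((deg j choose 2) + deg j) + 2 * (r choose 2) = (deg j * r + ((deg j - r choose 2) + (r choose 2))) + s"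
      using highest_exponent[OF rs[symmetric]] rs unfolding s[symmetric] by linarith
    have sign: "(- 1) ^ deg j * (- 1) ^ r = ((- 1) ^ s :: qpi)"
      unfolding rs power_add by (simp add: mult_ac flip: power_mult_distrib)
    have "u * ((- 1) ^ r * v ^ (r choose 2) * twist j ^ r * Q' ^ ((deg j - r choose 2) + (r choose 2)))
      = ((- 1) ^ deg j * (- 1) ^ r) * (P ^ (deg j choose 2) * P ^ (r choose 2) * pivar ^ (r * par D i * par D j))
        * (Q ^ (((deg j choose 2) + deg j) + 2 * (r choose 2)) * Q' ^ (deg j * r + ((deg j - r choose 2) + (r choose 2))))"
      unfolding u_def v_def twist_def by (simp only: power_mult_distrib power_add power_mult[symmetric] mult_ac)
    also have "Q ^ (((deg j choose 2) + deg j) + 2 * (r choose 2)) * Q' ^ (deg j * r + ((deg j - r choose 2) + (r choose 2))) = Q ^ s"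
      by (rule unit_power_cancel(1)[OF QQ e])
    also have "P ^ (deg j choose 2) * P ^ (r choose 2) * pivar ^ (r * par D i * par D j)
      = P ^ (s * par D i * par D j + (s choose 2) * par D i) * P ^ s"
    proof (cases "i \<in> odd_part D")
      case True
      then have "even (deg j)" using cartan_odd[OF True, of j] by (simp add: cartan_deg[OF assms])
      \<comment> \<open>Modulo 2 the sum is (r + s) p(j) + s (r + 1), which is even because r and s
        have the same parity.\<close>
      then have "even ((deg j choose 2) + (r choose 2) + r * par D j + (s * par D j + (s choose 2) + s))"
        unfolding rs choose_two_add by (auto simp: even_add)
      moreover have "par D i = 1" "P = pivar" using True by (simp_all add: P_eq par_def)
      ultimately show ?thesis
        by (simp only: mult_1_right power_add[symmetric]) (rule pivar_power_cong)
    qed (simp add: P_eq par_def)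
    finally show ?thesis unfolding sign by (simp only: P_def Q_def power_mult_distrib mult.assoc)
  qed
  have "(\<Sum>(r, s) \<in> {(r, s). int r + int s = - cartan D i j}.
        scal ((- 1) ^ r * pi_at D i ^ (r * par D i * par D j + (r choose 2) * par D i)
              * (pi_at D i * q_at D i) ^ r)
        * fE_div D i r * fE j * fE_div D i s) = sc u (highest E j)"
    unfolding sum_pairs(2)[OF assms] highest_expand fa.scm.scale_sum_right
    by (intro sum.cong refl)
      (simp add: coeff[OF _ refl, unfolded mult.assoc] fE_div_eq[symmetric] sc_alg_def[symmetric] mult.assoc)
  then have "braid_E D i j = sc p (J ^ par D j * sc u (highest E j))"
    unfolding braid_E_def p_def by (simp add: sc_alg_def mult.assoc)
  then show ?thesis using puu S by auto
qed

section \<open>Commutation with torus elements\<close>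

lemma J_highest: "J * highest E j \<approx> highest E j * J" "J * highest F j \<approx> highest F j * J"
proof -
  have highest: "J * highest X j \<approx> highest X j * J" if X: "\<And>k. J * X k \<approx> X k * J" for X
  proof -
    have prod: "J * (x * y) \<approx> (x * y) * J" if "J * x \<approx> x * J" "J * y \<approx> y * J" for x y
    proof -
      have "J * (x * y) = (J * x) * y" by (simp add: mult.assoc)
      also have "\<dots> \<approx> (x * J) * y" by (intro eqv_mult eqv_refl that)
      also have "\<dots> = x * (J * y)" by (simp add: mult.assoc)
      also have "\<dots> \<approx> x * (y * J)" by (intro eqv_mult eqv_refl that)
      finally show ?thesis by (simp add: mult.assoc)
    qed
    have "J * fa.skew v (X i) n c (X j) \<approx> fa.skew v (X i) n c (X j) * J" for n c
    proof (induction n)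
      case (Suc n)
      let ?y = "fa.skew v (X i) n c (X j)"
      have "J * fa.skew v (X i) (Suc n) c (X j) = J * (X i * ?y) - sc (v ^ n * c) (J * (?y * X i))"
        by (simp add: right_diff_distrib)
      also have "\<dots> \<approx> (X i * ?y) * J - sc (v ^ n * c) ((?y * X i) * J)"
        by (intro eqv_diff eqv_sc prod X Suc)
      also have "\<dots> = fa.skew v (X i) (Suc n) c (X j) * J"
        by (simp add: left_diff_distrib)
      finally show ?case .
    qed (simp add: X)
    then show ?thesis unfolding highest_def by (simp add: eqv_sc)
  qed
  then show "J * highest E j \<approx> highest E j * J" "J * highest F j \<approx> highest F j * J"
    by - (rule highest, rule J_commutes)+
qed

lemma torus_commutes: "J * J \<approx> sc 1 (J * J)" "J * K \<approx> sc 1 (K * J)" "J * K' \<approx> sc 1 (K' * J)"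
  "K' * J \<approx> sc 1 (J * K')" "K' * K \<approx> sc 1 (K * K')" "K * K' \<approx> sc 1 (K' * K)"
  using J_commutes(3) eqv_sym[OF J_commutes(3)] eqv_trans[OF K'_K eqv_sym[OF K_K']]
    eqv_trans[OF K_K' eqv_sym[OF K'_K]]
  by (simp_all add: fKt_def fKt'_def)

lemma PP_left: "P * (P * a) = a"
  using PP by (simp add: power2_eq_square flip: mult.assoc)

section \<open>Integrality of braid images and the way back\<close>

lemma J_B: "J \<in> B"
  by (simp add: fJt_def fJ_B)

lemma fact_inv_divided: "sc (1 / q_fact D i a) (x ^ a) \<in> B \<Longrightarrow> sc (fact_inv a) (x ^ a) \<in> B"
  using B_sc[OF int_scalars_power[OF unit_scalars(3)], of "sc (1 / q_fact D i a) (x ^ a)" "a choose 2"]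
  by (simp add: fact_inv_def)

lemma J_power_square: "J ^ p * (J ^ p * x) \<approx> x"
proof -
  have "J ^ p * (J ^ p * x) = (J ^ 2) ^ p * x"
    by (simp add: mult.assoc mult_2 power_add flip: power_mult)
  also have "\<dots> \<approx> 1 ^ p * x" by (intro eqv_mult eqv_power eqv_refl J_square)
  finally show ?thesis by simp
qed

lemma J_power_commute: "J * y \<approx> y * J \<Longrightarrow> y * J ^ p \<approx> sc 1 (J ^ p * y)"
  using eqv_sym[OF commute_power[of J y 1 p]] by simp

text \<open>The factor J^p lies in \<open>B\<close> and commutes with \<open>y\<close>, so it does
  not disturb the integrality of divided powers.\<close>

lemma J_product_integral:
  assumes z: "z \<approx> sc u (J ^ p * y)" and u: "u \<in> int_scalars"
    and y: "J * y \<approx> y * J" "sc a (y ^ n) \<in> B"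
  shows "sc a (z ^ n) \<in> B"
  using B_mult[OF B_power[OF B_power[OF J_B]] y(2), of p n]
  by (intro product_power_integral[OF z J_power_commute[OF y(1)] u int_scalars_one]) simp

text \<open>Up to a power of \<open>J\<close> and a unit the image is the highest vector, whose
  divided powers are integral by the Leibniz argument. \<open>z\<close> stands for any
  representative of T(E_j) or T(F_j).\<close>

lemma braid_power_integral:
  assumes ij: "i \<noteq> j"
  shows "(\<And>a. fE_div D i a \<in> B) \<Longrightarrow> fE_div D j n \<in> B \<Longrightarrow> z \<approx> braid_E D i j
      \<Longrightarrow> sc (1 / q_fact D j n) (z ^ n) \<in> B"
    and "(\<And>a. fF_div D i a \<in> B) \<Longrightarrow> fF_div D j n \<in> B \<Longrightarrow> z \<approx> braid_F D i j
      \<Longrightarrow> sc (1 / q_fact D j n) (z ^ n) \<in> B"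
proof -
  note hp = skew_divided_power_integral[OF fact_inv skew_serre_I(1)[OF ij] unit_scalars(4) twist_scalars twist_twist']
  assume "\<And>a. fE_div D i a \<in> B" "fE_div D j n \<in> B" and z: "z \<approx> braid_E D i j"
  then have y: "sc (1 / q_fact D j n) (highest E j ^ n) \<in> B"
    unfolding highest_def by (intro hp fact_inv_divided) (simp_all add: fE_div_eq)
  obtain u where u: "u \<in> int_scalars" "z \<approx> sc u (J ^ par D j * highest E j)"
    using braid_E_highest[OF ij] z by auto
  show "sc (1 / q_fact D j n) (z ^ n) \<in> B"
    by (rule J_product_integral[OF u(2,1) J_highest(1) y])
next
  note hp = skew_divided_power_integral[OF fact_inv skew_serre_I(2)[OF ij] unit_scalars(4) twist_scalars twist_twist']
  assume "\<And>a. fF_div D i a \<in> B" "fF_div D j n \<in> B" and z: "z \<approx> braid_F D i j"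
  then have y: "sc (1 / q_fact D j n) (highest F j ^ n) \<in> B"
    unfolding highest_def by (intro hp fact_inv_divided) (simp_all add: fF_div_eq)
  have "z \<approx> sc (Q ^ (deg j choose 2)) (J ^ par D j * highest F j)"
    using z by (simp add: braid_F_highest[OF ij])
  then show "sc (1 / q_fact D j n) (z ^ n) \<in> B"
    by (rule J_product_integral[OF _ int_scalars_power[OF unit_scalars(2)] J_highest(2) y])
qed

lemma J_commute_scaled:
  assumes "J * y \<approx> y * J" "z \<approx> sc u (J ^ p * y)"
  shows "J * z \<approx> z * J"
proof -
  have "J * (J ^ p) \<approx> sc 1 (J ^ p * J)" by (simp add: power_commutes)
  then have "J * (J ^ p * y) \<approx> sc (1 * 1) (J ^ p * y * J)"
    by (rule commute_mult_right) (simp add: assms)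
  then have "J * z \<approx> sc (1 * 1) (z * J)" by (rule commute_eqv[OF assms(2)])
  then show ?thesis by simp
qed

lemma J_scaled_inverse: "z \<approx> sc u (J ^ p * y) \<Longrightarrow> u * u' = 1 \<Longrightarrow> y \<approx> sc u' (J ^ p * z)"
proof -
  assume z: "z \<approx> sc u (J ^ p * y)" and u: "u * u' = 1"
  have "sc u' (J ^ p * z) \<approx> sc u' (J ^ p * sc u (J ^ p * y))" by (intro eqv_sc eqv_mult eqv_refl z)
  also have "\<dots> = J ^ p * (J ^ p * y)" using u by (simp add: mult.commute)
  also have "\<dots> \<approx> y" by (rule J_power_square)
  finally show ?thesis by (rule eqv_sym)
qed

text \<open>Stripping the unit and the power of \<open>J\<close> from \<open>z\<close> recovers the
  highest vector, from which the partner in \<open>lowest_weight_E\<close> or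
  \<open>lowest_weight_F\<close> descends. The divided powers of the partner come from the
  \<open>preimage_power_integral\<close> lemmas.\<close>

lemma power_integral_of_braid:
  assumes ij: "i \<noteq> j"
  shows "(\<And>a. sc (1 / q_fact D i a) ((F i * K) ^ a) \<in> B) \<Longrightarrow> z \<approx> braid_E D i j
      \<Longrightarrow> sc (1 / q_fact D j n) (z ^ n) \<in> B \<Longrightarrow> fE_div D j n \<in> B"
    and "(\<And>a. sc (1 / q_fact D i a) (sc P (J * E i * K') ^ a) \<in> B) \<Longrightarrow> z \<approx> braid_F D i j
      \<Longrightarrow> sc (1 / q_fact D j n) (z ^ n) \<in> B \<Longrightarrow> fF_div D j n \<in> B"
proof -
  interpret E: lowest_weight sc "rel_ideal D" B v w "twist j" "twist' j" Q Q' "1 / q_den D i"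
    "E i" "F i * K" "J * K * K" "E j" "deg j" by (rule lowest_weight_E[OF ij])
  assume g: "\<And>a. sc (1 / q_fact D i a) ((F i * K) ^ a) \<in> B" and z: "z \<approx> braid_E D i j"
    and zn: "sc (1 / q_fact D j n) (z ^ n) \<in> B"
  obtain u u' where u: "u * u' = 1" "u' \<in> int_scalars" "z \<approx> sc u (J ^ par D j * highest E j)"
    using braid_E_highest[OF ij] z by auto
  have "sc (1 / q_fact D j n) (highest E j ^ n) \<in> B"
    by (rule J_product_integral[OF J_scaled_inverse[OF u(3,1)] u(2) J_commute_scaled[OF J_highest(1) u(3)] zn])
  then show "fE_div D j n \<in> B"
    unfolding fE_div_eq highest_def
    by (intro E.power_integral_of_skew[OF fact_inv fact_inv_divided[OF g]])
next
  interpret F: lowest_weight sc "rel_ideal D" B v w "twist j" "twist' j" Q Q' "1 / q_den D i"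
    "F i" "sc P (J * E i * K')" "J * K' * K'" "F j" "deg j" by (rule lowest_weight_F[OF ij])
  assume g: "\<And>a. sc (1 / q_fact D i a) (sc P (J * E i * K') ^ a) \<in> B" and z: "z \<approx> braid_F D i j"
    and zn: "sc (1 / q_fact D j n) (z ^ n) \<in> B"
  have z: "z \<approx> sc (Q ^ (deg j choose 2)) (J ^ par D j * highest F j)"
    using z by (simp add: braid_F_highest[OF ij])
  have u: "Q ^ (deg j choose 2) * Q' ^ (deg j choose 2) = 1" by (simp add: QQ flip: power_mult_distrib)
  have "sc (1 / q_fact D j n) (highest F j ^ n) \<in> B"
    by (rule J_product_integral[OF J_scaled_inverse[OF z u] int_scalars_power[OF unit_scalars(3)]
          J_commute_scaled[OF J_highest(2) z] zn])
  then show "fF_div D j n \<in> B"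
    unfolding fF_div_eq highest_def
    by (intro F.power_integral_of_skew[OF fact_inv fact_inv_divided[OF g]])
qed

text \<open>At the vertex i itself the images are monomials in F_i or E_i and torus elements that
  commute with it up to a power of q_i, so sorting the product is enough.\<close>

lemma image_power_integral:
  assumes K_B: "\<And>\<mu>. fK \<mu> \<in> B"
  shows "fF_div D i n \<in> B \<Longrightarrow> z \<approx> sc (- P) (J * K * F i) \<Longrightarrow> sc (1 / q_fact D i n) (z ^ n) \<in> B"
    and "fE_div D i n \<in> B \<Longrightarrow> z \<approx> sc (- 1) (E i * K') \<Longrightarrow> sc (1 / q_fact D i n) (z ^ n) \<in> B"
proof -
  have KB: "K \<in> B" "K' \<in> B" by (simp_all add: fKt_def fKt'_def K_B)
  have QQ2: "Q' ^ 2 * Q ^ 2 = 1" by (simp add: QQ mult.commute flip: power_mult_distrib)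
  assume "fF_div D i n \<in> B" and z: "z \<approx> sc (- P) (J * K * F i)"
  then have "(J * K) ^ n * sc (1 / q_fact D i n) (F i ^ n) \<in> B"
    by (intro B_mult B_power J_B KB) (simp add: fF_div_eq)
  moreover have FJK: "F i * (J * K) \<approx> sc (Q ^ 2) (J * K * F i)"
    using commute_mult[OF J_commutes'(2) K_weights(2)] by (intro commute_inverse[OF _ QQ2]) simp
  ultimately show "sc (1 / q_fact D i n) (z ^ n) \<in> B"
    by (intro product_power_integral[OF z FJK] int_scalars_intros unit_scalars) simp_all
next
  have KB: "K \<in> B" "K' \<in> B" by (simp_all add: fKt_def fKt'_def K_B)
  assume "fE_div D i n \<in> B" and z: "z \<approx> sc (- 1) (E i * K')"
  then have "sc (1 / q_fact D i n) (E i ^ n) * K' ^ n \<in> B"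
    by (intro B_mult B_power J_B KB) (simp add: fE_div_eq)
  then show "sc (1 / q_fact D i n) (z ^ n) \<in> B"
    by (intro product_power_integral[OF z K_weights(3)] int_scalars_intros unit_scalars) simp_all
qed

text \<open>Solving z = -\<pi>_i J K F_i gives F_i = -\<pi>_i J K' z and F_i K = -\<pi>_i q_i^2 J z,
  where \<open>z\<close> commutes with the torus factors up to powers of q_i. The second element is
  the partner in \<open>lowest_weight_E\<close>.\<close>

lemma preimage_power_integral_E:
  assumes K_B: "\<And>\<mu>. fK \<mu> \<in> B" and z: "z \<approx> sc (- P) (J * K * F i)"
    and zn: "sc (1 / q_fact D i n) (z ^ n) \<in> B"
  shows "fF_div D i n \<in> B" "sc (1 / q_fact D i n) ((F i * K) ^ n) \<in> B"
proof -
  have KB: "K \<in> B" "K' \<in> B" by (simp_all add: fKt_def fKt'_def K_B)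
  have QQ2: "Q ^ 2 * Q' ^ 2 = 1" by (simp add: QQ flip: power_mult_distrib)
  have Jz: "J * z \<approx> sc (- P) (K * F i)"
  proof -
    have "J * z \<approx> J * sc (- P) (J * K * F i)" by (intro eqv_mult eqv_refl z)
    also have "\<dots> = sc (- P) (J ^ 2 * (K * F i))" by (simp add: power2_eq_square mult.assoc)
    also have "\<dots> \<approx> sc (- P) (1 * (K * F i))" by (intro eqv_sc eqv_mult eqv_refl J_square)
    finally show ?thesis by simp
  qed
  have J_z: "J * z \<approx> sc 1 (z * J)"
    using commute_mult_right[OF commute_mult_right[OF torus_commutes(1,2)] J_commutes'(2)]
    by (intro commute_eqv[OF z]) simp
  then have zJ: "z * J \<approx> sc 1 (J * z)" by (rule commute_inverse) simp
  have FK: "F i * K \<approx> sc (- (P * Q ^ 2)) (J * z)"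
  proof -
    have "F i * K \<approx> sc (Q ^ 2) (K * F i)"
      by (rule commute_inverse[OF K_weights(2)]) (use QQ2 in \<open>simp add: mult.commute\<close>)
    also have "\<dots> = sc (- (P * Q ^ 2)) (sc (- P) (K * F i))"
      by (simp add: power2_eq_square mult_ac PP_left)
    also have "\<dots> \<approx> sc (- (P * Q ^ 2)) (J * z)" by (intro eqv_sc eqv_sym[OF Jz])
    finally show ?thesis .
  qed
  have "J ^ n * sc (1 / q_fact D i n) (z ^ n) \<in> B"
    by (intro B_mult B_power J_B zn)
  then show "sc (1 / q_fact D i n) ((F i * K) ^ n) \<in> B"
    by (intro product_power_integral[OF FK zJ] int_scalars_intros unit_scalars) simp_all
  have F: "F i \<approx> sc (- P) (J * K' * z)"
  proof -
    have "sc (- P) (J * K' * z) \<approx> sc (- P) (J * K' * sc (- P) (J * K * F i))"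
      by (intro eqv_sc eqv_mult eqv_refl z)
    also have "\<dots> = J * (K' * J) * (K * F i)"
      using PP by (simp add: power2_eq_square mult.assoc)
    also have "\<dots> \<approx> J * (J * K') * (K * F i)"
      unfolding fKt'_def by (intro eqv_mult eqv_refl eqv_sym[OF J_commutes(3)])
    also have "\<dots> = J ^ 2 * (K' * K) * F i" by (simp add: power2_eq_square mult.assoc)
    also have "\<dots> \<approx> 1 * 1 * F i" by (intro eqv_mult eqv_refl J_square K'_K)
    finally show ?thesis by (simp add: eqv_sym)
  qed
  have zJK: "z * (J * K') \<approx> sc (Q' ^ 2) (J * K' * z)"
  proof (rule commute_inverse[OF _ QQ2])
    have "K' * z \<approx> sc (Q ^ 2) (z * K')"
      using commute_mult_right[OF commute_mult_right[OF torus_commutes(4,5)] K_weights(4)]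
      by (intro commute_eqv[OF z]) simp
    then show "J * K' * z \<approx> sc (Q ^ 2) (z * (J * K'))"
      using commute_mult[OF J_z] by simp
  qed
  have "(J * K') ^ n * sc (1 / q_fact D i n) (z ^ n) \<in> B"
    by (intro B_mult B_power J_B KB zn)
  then show "fF_div D i n \<in> B"
    unfolding fF_div_eq
    by (intro product_power_integral[OF F zJK] int_scalars_intros unit_scalars) simp_all
qed

text \<open>Solving z = -E_i K' gives E_i = -z K, and the partner in \<open>lowest_weight_F\<close>
  becomes -\<pi>_i J z.\<close>

lemma preimage_power_integral_F:
  assumes K_B: "\<And>\<mu>. fK \<mu> \<in> B" and z: "z \<approx> sc (- 1) (E i * K')"
    and zn: "sc (1 / q_fact D i n) (z ^ n) \<in> B"
  shows "fE_div D i n \<in> B" "sc (1 / q_fact D i n) (sc P (J * E i * K') ^ n) \<in> B"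
proof -
  have KB: "K \<in> B" "K' \<in> B" by (simp_all add: fKt_def fKt'_def K_B)
  have z': "E i * K' \<approx> sc (- 1) z" using eqv_sc[OF z, of "- 1"] by (simp add: eqv_sym)
  have "J * z \<approx> sc 1 (z * J)"
    using commute_mult_right[OF J_commutes'(1) torus_commutes(3)] by (intro commute_eqv[OF z]) simp
  then have zJ: "z * J \<approx> sc 1 (J * z)" by (rule commute_inverse) simp
  have g: "sc P (J * E i * K') \<approx> sc (- P) (J * z)"
    using eqv_sc[OF eqv_mult[OF eqv_refl z'], of P J] by (simp add: mult.assoc)
  have "J ^ n * sc (1 / q_fact D i n) (z ^ n) \<in> B"
    by (intro B_mult B_power J_B zn)
  then show "sc (1 / q_fact D i n) (sc P (J * E i * K') ^ n) \<in> B"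
    by (intro product_power_integral[OF g zJ] int_scalars_intros unit_scalars) simp_all
  have E: "E i \<approx> sc (- 1) (z * K)"
  proof -
    have "sc (- 1) (z * K) \<approx> sc (- 1) (sc (- 1) (E i * K') * K)"
      by (intro eqv_sc eqv_mult eqv_refl z)
    also have "\<dots> = E i * (K' * K)" by (simp add: mult.assoc)
    also have "\<dots> \<approx> E i * 1" by (intro eqv_mult eqv_refl K'_K)
    finally show ?thesis by (simp add: eqv_sym)
  qed
  have Kz: "K * z \<approx> sc (Q ^ 2) (z * K)"
    using commute_mult_right[OF K_weights(1) torus_commutes(6)] by (intro commute_eqv[OF z]) simp
  have "sc (1 / q_fact D i n) (z ^ n) * K ^ n \<in> B"
    by (intro B_mult B_power KB zn)
  then show "fE_div D i n \<in> B"
    unfolding fE_div_eq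
    by (intro product_power_integral[OF E Kz] int_scalars_intros unit_scalars) simp_all
qed

end

section \<open>Descent to the quotient\<close>

lemma cls_simps:
  "cls D x \<otimes>\<^bsub>U D\<^esub> cls D y = cls D (x * y)"
  "cls D x \<oplus>\<^bsub>U D\<^esub> cls D y = cls D (x + y)"
  "\<one>\<^bsub>U D\<^esub> = cls D 1"
  using cls_ring_hom[of D] by (auto simp: ring_hom_def free_alg_ring_def)

lemma cls_uminus: "\<ominus>\<^bsub>U D\<^esub> cls D x = cls D (- x)"
proof -
  interpret ring "U D" by (rule ring_U)
  have zero: "\<zero>\<^bsub>U D\<^esub> = cls D 0"
    using cls_simps(2)[of D 0 0] carrier_U[of D]
    by (metis add.r_cancel_one' add_0 rangeI)
  show ?thesis
    by (rule add.inv_equality) (simp_all add: carrier_U cls_simps zero)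
qed

text \<open>Phrased on representatives, since the integrality arguments run in the free
  algebra.\<close>

lemma is_subalgebra_iff:
  "is_subalgebra S (U D) H \<longleftrightarrow> H \<subseteq> range (cls D) \<and> cls D 1 \<in> H \<and> (\<forall>x. cls D x \<in> H \<longrightarrow> cls D (- x) \<in> H) \<and>
    (\<forall>x y. cls D x \<in> H \<longrightarrow> cls D y \<in> H \<longrightarrow> cls D (x + y) \<in> H \<and> cls D (x * y) \<in> H) \<and>
    (\<forall>c\<in>S. \<forall>x. cls D x \<in> H \<longrightarrow> cls D (scal c * x) \<in> H)"
    (is "_ \<longleftrightarrow> ?R")
proof -
  interpret ring "U D" by (rule ring_U)
  show ?thesis
  proof
    assume H: "is_subalgebra S (U D) H"
    then have s: "subring H (U D)" by (simp add: is_subalgebra_def)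
    have "\<forall>c\<in>S. \<forall>x. cls D x \<in> H \<longrightarrow> cls D (scal c * x) \<in> H"
      using H by (auto simp: is_subalgebra_def simp flip: smult_U)
    then show ?R
      using subringE[OF s] by (simp add: carrier_U flip: cls_simps cls_uminus)
  next
    assume ?R
    then have H: "H \<subseteq> range (cls D)" "cls D 1 \<in> H" "\<And>x. cls D x \<in> H \<Longrightarrow> cls D (- x) \<in> H"
      "\<And>x y. cls D x \<in> H \<Longrightarrow> cls D y \<in> H \<Longrightarrow> cls D (x + y) \<in> H"
      "\<And>x y. cls D x \<in> H \<Longrightarrow> cls D y \<in> H \<Longrightarrow> cls D (x * y) \<in> H"
      "\<And>c x. c \<in> S \<Longrightarrow> cls D x \<in> H \<Longrightarrow> cls D (scal c * x) \<in> H" by blast+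
    have cls: "\<exists>y. x = cls D y" if "x \<in> H" for x using H(1) that by blast
    have "subring H (U D)"
    proof (rule subringI)
      show "H \<subseteq> carrier (U D)" "\<one>\<^bsub>U D\<^esub> \<in> H" using H by (auto simp: carrier_U cls_simps)
      fix x y assume "x \<in> H" "y \<in> H"
      then obtain x' y' where "x = cls D x'" "y = cls D y'" using cls by metis
      with H \<open>x \<in> H\<close> \<open>y \<in> H\<close> show "\<ominus>\<^bsub>U D\<^esub> x \<in> H" "x \<otimes>\<^bsub>U D\<^esub> y \<in> H" "x \<oplus>\<^bsub>U D\<^esub> y \<in> H"
        by (auto simp: cls_simps cls_uminus)
    qed
    moreover have "c \<odot>\<^bsub>U D\<^esub> x \<in> H" if "c \<in> S" "x \<in> H" for c x
      using cls[OF that(2)] that H(6) by (auto simp: smult_U)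
    ultimately show "is_subalgebra S (U D) H" by (simp add: is_subalgebra_def)
  qed
qed

lemma is_subalgebra_carrier: "is_subalgebra S (U D) (carrier (U D))"
  unfolding is_subalgebra_iff carrier_U by blast

lemma subalgebra_generated_least:
  "is_subalgebra S V H \<Longrightarrow> G \<subseteq> H \<Longrightarrow> subalgebra_generated S V G \<subseteq> H"
  by (auto simp: subalgebra_generated_def)

lemma generators_subalgebra_generated: "G \<subseteq> subalgebra_generated S V G"
  by (auto simp: subalgebra_generated_def)

text \<open>The carrier itself is one of the subalgebras containing \<open>G\<close>, so the
  intersection stays inside it.\<close>

lemma is_subalgebra_generated:
  assumes "G \<subseteq> carrier (U D)"
  shows "is_subalgebra S (U D) (subalgebra_generated S (U D) G)"
proof -
  have "subalgebra_generated S (U D) G \<subseteq> range (cls D)"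
    using subalgebra_generated_least[OF is_subalgebra_carrier assms] by (simp add: carrier_U)
  then show ?thesis
    unfolding is_subalgebra_iff[of S D "subalgebra_generated S (U D) G"]
    by (simp add: subalgebra_generated_def is_subalgebra_iff)
qed

text \<open>\<open>U_int D\<close> differs from \<open>U D\<close> only in its carrier, so the
  operations are inherited and the image condition supplies bijectivity.\<close>

lemma restrict_automorphism:
  assumes h: "h \<in> ring_iso (U D) (U D)" and scale: "\<And>c x. x \<in> carrier (U D) \<Longrightarrow> h (c \<odot>\<^bsub>U D\<^esub> x) = c \<odot>\<^bsub>U D\<^esub> h x"
    and H: "carrier (U_int D) \<subseteq> carrier (U D)" "h ` carrier (U_int D) = carrier (U_int D)"
  shows "algebra_automorphism S (U_int D) h"
proof -
  have U: "mult (U_int D) = mult (U D)" "add (U_int D) = add (U D)" "one (U_int D) = one (U D)"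
    "smult (U_int D) = smult (U D)"
    by (simp_all add: U_int_def)
  have "h \<in> ring_hom (U D) (U D)" "bij_betw h (carrier (U D)) (carrier (U D))"
    using h by (auto simp: ring_iso_def)
  then have "h \<in> ring_hom (U_int D) (U_int D)" "bij_betw h (carrier (U_int D)) (carrier (U_int D))"
    using H by (auto simp: ring_hom_def U subset_iff bij_betw_def intro: inj_on_subset)
  then show ?thesis
    using scale H by (auto simp: algebra_automorphism_def ring_iso_def U subset_iff)
qed

text \<open>Elements of the ideal have the class of 0, which lies in \<open>H\<close>; hence the
  preimage contains the ideal.\<close>

lemma integral_form_subalgebra:
  assumes "is_subalgebra S (U D) H"
  shows "integral_form sc_alg (rel_ideal D) {x. cls D x \<in> H}"
proof -
  interpret ideal "rel_ideal D" free_alg_ring by (rule ideal_rel_ideal)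
  have H: "cls D 1 \<in> H" "\<And>x. cls D x \<in> H \<Longrightarrow> cls D (- x) \<in> H"
      "\<And>x y. cls D x \<in> H \<Longrightarrow> cls D y \<in> H \<Longrightarrow> cls D (x + y) \<in> H"
      "\<And>x y. cls D x \<in> H \<Longrightarrow> cls D y \<in> H \<Longrightarrow> cls D (x * y) \<in> H"
    using assms unfolding is_subalgebra_iff by blast+
  have zero: "cls D 0 \<in> H" using H(3)[OF H(1) H(2)[OF H(1)]] by simp
  have sub: "rel_ideal D \<subseteq> {x. cls D x \<in> H}"
  proof
    fix x assume "x \<in> rel_ideal D"
    then have "cls D x = cls D 0" by (simp add: cls_eq_iff)
    then show "x \<in> {x. cls D x \<in> H}" using zero by simp
  qed
  note I = additive_subgroup.zero_closed[OF is_additive_subgroup]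
      additive_subgroup.a_closed[OF is_additive_subgroup] I_l_closed I_r_closed
  show ?thesis
    by unfold_locales (use sub H I in \<open>simp_all add: free_alg_ring_def\<close>)
qed

section \<open>The integral form under a braid automorphism\<close>

locale braid_automorphism = covering_datum D
  for D :: "('i::finite, 'x::ab_group_add, 'y::ab_group_add) super_datum" +
  fixes i :: 'i and T :: "('i, 'y) falg set \<Rightarrow> ('i, 'y) falg set"
  assumes braid: "is_braid_automorphism D i T"
begin

abbreviation "UA \<equiv> carrier (U_int D)"

text \<open>A chosen representative of the image. Sums and products need be respected only after
  passing to classes, as in \<open>lift_hom\<close>.\<close>

definition lift :: "('i, 'y) falg \<Rightarrow> ('i, 'y) falg" where
  "lift x = (SOME y. T (cls D x) = cls D y)"

lemma UA_subalgebra: "is_subalgebra scalarsA (U D) UA"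
  by (auto simp: U_int_def carrier_U intro!: is_subalgebra_generated)

lemma UA_subset: "UA \<subseteq> carrier (U D)"
  using UA_subalgebra unfolding is_subalgebra_iff carrier_U by blast

lemma UA_generators:
  "cls D (fE_div D j n) \<in> UA" "cls D (fF_div D j n) \<in> UA" "cls D (fJ \<nu>) \<in> UA" "cls D (fK \<nu>) \<in> UA"
  unfolding U_int_def by (auto intro!: subsetD[OF generators_subalgebra_generated])

lemma UA_least:
  assumes "is_subalgebra scalarsA (U D) H"
    and "\<And>j n. cls D (fE_div D j n) \<in> H" "\<And>j n. cls D (fF_div D j n) \<in> H"
    "\<And>\<nu>. cls D (fJ \<nu>) \<in> H" "\<And>\<nu>. cls D (fK \<nu>) \<in> H"
  shows "UA \<subseteq> H"
proof -
  have "subalgebra_generated scalarsA (U D) ({cls D (fE_div D i n) | i n. True} \<union>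
      {cls D (fF_div D i n) | i n. True} \<union> {cls D (fJ \<nu>) | \<nu>. True} \<union> {cls D (fK \<nu>) | \<nu>. True}) \<subseteq> H"
    using assms by (intro subalgebra_generated_least) auto
  then show ?thesis by (simp add: U_int_def)
qed

lemma T_iso: "T \<in> ring_iso (U D) (U D)"
  and T_scale: "x \<in> carrier (U D) \<Longrightarrow> T (c \<odot>\<^bsub>U D\<^esub> x) = c \<odot>\<^bsub>U D\<^esub> T x"
  using braid by (auto simp: is_braid_automorphism_def algebra_automorphism_def)

lemma T_cls: "T (cls D x) = cls D (lift x)"
proof -
  have "T (cls D x) \<in> carrier (U D)"
    using T_iso by (auto simp: ring_iso_def ring_hom_def carrier_U)
  then have "\<exists>y. T (cls D x) = cls D y" by (auto simp: carrier_U)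
  then show ?thesis unfolding lift_def by (rule someI_ex)
qed

lemma lift_hom:
  "cls D (lift (x * y)) = cls D (lift x * lift y)" "cls D (lift (x + y)) = cls D (lift x + lift y)"
  "cls D (lift 1) = cls D 1" "cls D (lift (scal c * x)) = cls D (scal c * lift x)"
  "cls D (lift (- x)) = cls D (- lift x)"
proof -
  have T: "T \<in> ring_hom (U D) (U D)" using T_iso by (simp add: ring_iso_def)
  have c: "cls D z \<in> carrier (U D)" for z by (simp add: carrier_U)
  show "cls D (lift (x * y)) = cls D (lift x * lift y)" for x y
    using ring_hom_mult[OF T c c, of x y] by (simp add: cls_simps T_cls)
  show "cls D (lift (x + y)) = cls D (lift x + lift y)"
    using ring_hom_add[OF T c c, of x y] by (simp add: cls_simps T_cls)
  show "cls D (lift 1) = cls D 1"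
    using ring_hom_one[OF T] by (simp add: cls_simps T_cls)
  show s: "cls D (lift (scal c * x)) = cls D (scal c * lift x)" for c x
    using T_scale[OF c, of c x] by (simp add: smult_U T_cls)
  have "scal (- 1) * z = - z" for z :: "('i, 'y) falg"
    using fa.scm.scale_minus_left[of 1 z, unfolded fa.sc_one] by (simp add: sc_alg_def)
  then show "cls D (lift (- x)) = cls D (- lift x)" using s[of "- 1" x] by simp
qed

lemma lift_values:
  "cls D (lift (fE i)) = cls D (- scal (pi_at D i) * fJt D i * fKt D i * fF i)"
  "cls D (lift (fF i)) = cls D (- fE i * fKt' D i)"
  "cls D (lift (fK \<mu>)) = cls D (fK (reflect D i \<mu>))"
  "cls D (lift (fJ \<mu>)) = cls D (fJ (reflect D i \<mu>))"
  "j \<noteq> i \<Longrightarrow> cls D (lift (fE j)) = cls D (braid_E D i j)"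
  "j \<noteq> i \<Longrightarrow> cls D (lift (fF j)) = cls D (braid_F D i j)"
  using braid by (simp_all add: is_braid_automorphism_def T_cls)

text \<open>As the diagonal Cartan entry is 2, reflecting negates the pairing with the root. This
  exhibits every J and K as an image under T.\<close>

lemma reflect_reflect: "reflect D i (reflect D i \<mu>) = \<mu>"
proof -
  have a: "Modules.additive (\<lambda>\<mu>. pairing D \<mu> (root D i))"
    using pairing_perfect unfolding perfect_pairing_def by blast
  have "pairing D (reflect D i \<mu>) (root D i) = - pairing D \<mu> (root D i)"
    unfolding reflect_def additive.diff[OF a] zmul_additive[OF a]
    by (simp add: pairing_cartan cartan_diag)
  then show ?thesis by (simp add: reflect_def zmod.scale_minus_left)
qed

text \<open>The image is the second choice of \<open>B\<close>; the preimage allows the inclusion of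
  T(UA) in UA to be checked on generators.\<close>

lemma image_subalgebra:
  "is_subalgebra scalarsA (U D) (T ` UA)" "is_subalgebra scalarsA (U D) {z \<in> carrier (U D). T z \<in> UA}"
proof -
  have UA: "UA \<subseteq> range (cls D)" "cls D 1 \<in> UA" "\<And>x. cls D x \<in> UA \<Longrightarrow> cls D (- x) \<in> UA"
    "\<And>x y. cls D x \<in> UA \<Longrightarrow> cls D y \<in> UA \<Longrightarrow> cls D (x + y) \<in> UA"
    "\<And>x y. cls D x \<in> UA \<Longrightarrow> cls D y \<in> UA \<Longrightarrow> cls D (x * y) \<in> UA"
    "\<And>c x. c \<in> scalarsA \<Longrightarrow> cls D x \<in> UA \<Longrightarrow> cls D (scal c * x) \<in> UA"
    using UA_subalgebra unfolding is_subalgebra_iff by blast+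
  have cong: "cls D a = cls D a' \<Longrightarrow> cls D b = cls D b' \<Longrightarrow>
      cls D (a + b) = cls D (a' + b') \<and> cls D (a * b) = cls D (a' * b') \<and> cls D (- a) = cls D (- a')
      \<and> cls D (scal c * a) = cls D (scal c * a')" for a b a' b' c
    by (simp flip: cls_simps cls_uminus smult_U)
  have im: "cls D x \<in> T ` UA \<longleftrightarrow> (\<exists>y. cls D y \<in> UA \<and> cls D x = cls D (lift y))" for x
  proof
    assume "cls D x \<in> T ` UA"
    then obtain z where z: "z \<in> UA" "cls D x = T z" by blast
    then obtain y where "z = cls D y" using UA(1) by blast
    with z show "\<exists>y. cls D y \<in> UA \<and> cls D x = cls D (lift y)" by (auto simp: T_cls)
  qed (auto simp flip: T_cls)
  show "is_subalgebra scalarsA (U D) (T ` UA)"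
    unfolding is_subalgebra_iff im
  proof (intro conjI allI ballI impI)
    show "T ` UA \<subseteq> range (cls D)" using UA(1) T_cls by fastforce
    show "\<exists>y. cls D y \<in> UA \<and> cls D 1 = cls D (lift y)" using UA(2) lift_hom(3) by metis
  next
    fix x assume "\<exists>y. cls D y \<in> UA \<and> cls D x = cls D (lift y)"
    then show "\<exists>y. cls D y \<in> UA \<and> cls D (- x) = cls D (lift y)"
      using UA(3) lift_hom(5) cong by metis
  next
    fix x y assume "\<exists>z. cls D z \<in> UA \<and> cls D x = cls D (lift z)" "\<exists>z. cls D z \<in> UA \<and> cls D y = cls D (lift z)"
    then obtain x' y' where UA': "cls D x' \<in> UA" "cls D y' \<in> UA"
      and x': "cls D x = cls D (lift x')" and y': "cls D y = cls D (lift y')"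
      by blast
    show "\<exists>z. cls D z \<in> UA \<and> cls D (x + y) = cls D (lift z)"
      using cong[OF x' y'] UA(4)[OF UA'] by (intro exI[of _ "x' + y'"]) (simp add: lift_hom)
    show "\<exists>z. cls D z \<in> UA \<and> cls D (x * y) = cls D (lift z)"
      using cong[OF x' y'] UA(5)[OF UA'] by (intro exI[of _ "x' * y'"]) (simp add: lift_hom)
  next
    fix c x assume c: "c \<in> scalarsA" and "\<exists>y. cls D y \<in> UA \<and> cls D x = cls D (lift y)"
    then obtain y where y: "cls D y \<in> UA" "cls D x = cls D (lift y)" by blast
    show "\<exists>y. cls D y \<in> UA \<and> cls D (scal c * x) = cls D (lift y)"
      using cong[OF y(2) y(2), of c] UA(6)[OF c y(1)] by (intro exI[of _ "scal c * y"]) (simp add: lift_hom(4))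
  qed
  show "is_subalgebra scalarsA (U D) {z \<in> carrier (U D). T z \<in> UA}"
    unfolding is_subalgebra_iff
    using UA by (simp add: carrier_U T_cls lift_hom(4)) (simp add: lift_hom)
qed

end

lemma quantum_integral_subalgebra:
  assumes "covering_datum D" "is_subalgebra scalarsA (U D) H" "\<And>\<nu>. cls D (fJ \<nu>) \<in> H"
  shows "quantum_integral D {x. cls D x \<in> H}"
proof -
  interpret covering_datum D by fact
  interpret integral_form sc_alg "rel_ideal D" "{x. cls D x \<in> H}"
    by (rule integral_form_subalgebra) fact
  have "cls D (scal c * 1) \<in> H" if "c \<in> scalarsA" for c
    using assms(2) that unfolding is_subalgebra_iff by blast
  then have "c \<in> int_scalars" if "c \<in> scalarsA" for c
    using that by (simp add: int_scalars_def sc_alg_def)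
  then show ?thesis
    using assms(3) scalarsA_generators by unfold_locales auto
qed

context braid_automorphism
begin

lemma lift_power: "cls D (lift (sc_alg a (x ^ n))) = cls D (sc_alg a (lift x ^ n))"
proof -
  have "cls D (lift (x ^ n)) = cls D (lift x ^ n)"
  proof (induction n)
    case (Suc n)
    then show ?case by (simp add: lift_hom flip: cls_simps)
  qed (simp add: lift_hom)
  then show ?thesis unfolding sc_alg_def lift_hom(4) smult_U[symmetric] by simp
qed

text \<open>For T(UA) \<subseteq> UA, take \<open>B\<close> to be the preimage of UA. For the
  converse take the preimage of T(UA): it contains the images of all divided powers by construction,
  and the descent recovers the divided powers themselves.\<close>

lemma T_UA: "T ` UA = UA"
proof
  interpret A: quantum_integral D "{x. cls D x \<in> UA}" i
    by (rule quantum_integral_subalgebra[OF covering_datum_axioms UA_subalgebra UA_generators(3)])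
  have eqv: "A.eqv x y \<longleftrightarrow> cls D x = cls D y" for x y
    by (simp add: A.eqv_def cls_eq_iff)
  have liftE: "A.eqv (lift (fE i)) (sc_alg (- A.P) (fJt D i * fKt D i * fF i))"
    unfolding eqv lift_values A.P_def by (simp add: sc_alg_def fa.scm.scale_minus_left[unfolded sc_alg_def] mult.assoc)
  have liftF: "A.eqv (lift (fF i)) (sc_alg (- 1) (fE i * fKt' D i))"
    unfolding eqv lift_values by (simp add: fa.scm.scale_minus_left)
  have lift_other: "A.eqv (lift (fE j)) (braid_E D i j)" "A.eqv (lift (fF j)) (braid_F D i j)" if "i \<noteq> j" for j
    unfolding eqv using lift_values(5,6)[of j] that by auto
  show "T ` UA \<subseteq> UA"
  proof -
    have "UA \<subseteq> {z \<in> carrier (U D). T z \<in> UA}"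
    proof (rule UA_least[OF image_subalgebra(2)])
      fix j n \<nu>
      show "cls D (fJ \<nu>) \<in> {z \<in> carrier (U D). T z \<in> UA}" "cls D (fK \<nu>) \<in> {z \<in> carrier (U D). T z \<in> UA}"
        by (simp_all add: carrier_U T_cls lift_values UA_generators)
      have "sc_alg (1 / q_fact D j n) (lift (fE j) ^ n) \<in> {x. cls D x \<in> UA}"
      proof (cases "i = j")
        case True
        show ?thesis
          unfolding True[symmetric] by (rule A.image_power_integral(1)[OF _ _ liftE]) (simp_all add: UA_generators)
      next
        case False
        show ?thesis
          by (rule A.braid_power_integral(1)[OF False _ _ lift_other(1)[OF False]]) (simp_all add: UA_generators)
      qed
      then show "cls D (fE_div D j n) \<in> {z \<in> carrier (U D). T z \<in> UA}"
        by (simp add: carrier_U T_cls A.fE_div_eq lift_power)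
      have "sc_alg (1 / q_fact D j n) (lift (fF j) ^ n) \<in> {x. cls D x \<in> UA}"
      proof (cases "i = j")
        case True
        show ?thesis
          unfolding True[symmetric] by (rule A.image_power_integral(2)[OF _ _ liftF]) (simp_all add: UA_generators)
      next
        case False
        show ?thesis
          by (rule A.braid_power_integral(2)[OF False _ _ lift_other(2)[OF False]]) (simp_all add: UA_generators)
      qed
      then show "cls D (fF_div D j n) \<in> {z \<in> carrier (U D). T z \<in> UA}"
        by (simp add: carrier_U T_cls A.fF_div_eq lift_power)
    qed
    then show ?thesis by auto
  qed
  have J: "cls D (fJ \<nu>) \<in> T ` UA" and K: "cls D (fK \<nu>) \<in> T ` UA" for \<nu>
    using lift_values(3,4)[of "reflect D i \<nu>"] UA_generators(3,4)[of "reflect D i \<nu>"]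
    by (auto simp: reflect_reflect simp flip: T_cls)
  interpret B: quantum_integral D "{x. cls D x \<in> T ` UA}" i
    by (rule quantum_integral_subalgebra[OF covering_datum_axioms image_subalgebra(1) J])
  have E: "sc_alg (1 / q_fact D j n) (lift (fE j) ^ n) \<in> {x. cls D x \<in> T ` UA}"
    and F: "sc_alg (1 / q_fact D j n) (lift (fF j) ^ n) \<in> {x. cls D x \<in> T ` UA}" for j n
    using UA_generators(1,2)[of j n] by (simp_all add: A.fE_div_eq A.fF_div_eq flip: lift_power T_cls)
  have K': "fK \<nu> \<in> {x. cls D x \<in> T ` UA}" for \<nu> using K by simp
  \<comment> \<open>T exchanges E_i and F_i up to torus factors. So \<open>preE\<close> yields the
    divided powers of F_i and of the partner used for E_j, while \<open>preF\<close> yields those of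
    E_i and of the partner used for F_j.\<close>
  note preE = B.preimage_power_integral_E[OF K' liftE E]
  note preF = B.preimage_power_integral_F[OF K' liftF F]
  show "UA \<subseteq> T ` UA"
  proof (rule UA_least[OF image_subalgebra(1) _ _ J K])
    fix j n
    have "fE_div D j n \<in> {x. cls D x \<in> T ` UA}"
    proof (cases "i = j")
      case False
      show ?thesis by (rule B.power_integral_of_braid(1)[OF False preE(2) lift_other(1)[OF False] E])
    qed (use preF(1) in simp)
    then show "cls D (fE_div D j n) \<in> T ` UA" by simp
    have "fF_div D j n \<in> {x. cls D x \<in> T ` UA}"
    proof (cases "i = j")
      case False
      show ?thesis by (rule B.power_integral_of_braid(2)[OF False preF(2) lift_other(2)[OF False] F])
    qed (use preE(1) in simp)
    then show "cls D (fF_div D j n) \<in> T ` UA" by simp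
  qed
qed

end

section \<open>Restricting the automorphism and its inverse\<close>

theorem corollary3p3p3:
  fixes D :: "('i::finite, 'x::ab_group_add, 'y::ab_group_add) super_datum"
    and i :: 'i
    and T :: "('i, 'y) falg set \<Rightarrow> ('i, 'y) falg set"
  assumes "covering_datum D"
    and "is_braid_automorphism D i T"
  shows "algebra_automorphism scalarsA (U_int D) T \<and>
         algebra_automorphism scalarsA (U_int D) (inv_into (carrier (U D)) T)"
proof -
  interpret covering_datum D by fact
  interpret braid_automorphism D i T by unfold_locales fact
  let ?T' = "inv_into (carrier (U D)) T"
  have bij: "bij_betw T (carrier (U D)) (carrier (U D))"
    using T_iso by (simp add: ring_iso_def)
  have inv: "?T' (T x) = x" if "x \<in> carrier (U D)" for x
    using bij that by (simp add: bij_betw_def)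
  \<comment> \<open>The inverse undoes T on the carrier only, and UA lies in it; so T(UA) = UA also
    gives the claim for the inverse.\<close>
  have "?T' ` T ` UA = (\<lambda>x. x) ` UA"
    unfolding image_image using UA_subset inv by (intro image_cong) auto
  then have im: "?T' ` UA = UA" by (simp add: T_UA)
  have iso: "?T' \<in> ring_iso (U D) (U D)"
    by (rule ring_iso_set_sym[OF ring_U T_iso])
  have scale: "?T' (c \<odot>\<^bsub>U D\<^esub> x) = c \<odot>\<^bsub>U D\<^esub> ?T' x" if "x \<in> carrier (U D)" for c x
  proof -
    have "x \<in> T ` carrier (U D)" using that by (simp add: bij_betw_imp_surj_on[OF bij])
    then obtain y where y: "y \<in> carrier (U D)" "x = T y" by blast
    moreover have "c \<odot>\<^bsub>U D\<^esub> y \<in> carrier (U D)" using y(1) by (auto simp: carrier_U smult_U)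
    ultimately show ?thesis by (simp add: inv flip: T_scale)
  qed
  show ?thesis
    using restrict_automorphism[OF T_iso T_scale UA_subset T_UA]
      restrict_automorphism[OF iso scale UA_subset im] by simp
qed

end
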